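(* Let $\mathcal{T}_{\mathbf{a}}$ be a label-regular tree such that $\mathrm{Aut}(\mathcal{T}_{\mathbf{a}})$ leaves no proper non-empty subtree and no end of $\mathcal{T}_{\mathbf{a}}$ invariant. Suppose that $\varphi:\mathrm{Aut}^+(\mathcal{T}_{\mathbf{a}})\to G$ is a continuous homomorphism to a topological group $G$. Then the range of $\varphi$ is closed in $G$.
   Context: All trees are infinite, locally finite, and all vertices have degree greater than $1$. An end of a tree is an equivalence class of rays (one-sided infinite paths without repeated vertices), two rays being equivalent if their intersection is a ray. A labelling of a tree $\mathcal{T}$ is a map $\lambda:V\mathcal{T}\to C$ to a set $C$ of labels. The labelled tree is label-regular if for each vertex $v$ the multiset of labels of the neighbours of $v$ depends only on $\lambda(v)$. Then $a_{ij}$ denotes the number of neighbours labelled $j$ of any vertex labelled $i$, $\mathbf{a}=(a_{ij})_{i,j\in C}$, and the tree, determined up to isomorphism by $\mathbf{a}$, is denoted $\mathcal{T}_{\mathbf{a}}$. $\mathrm{Aut}(\mathcal{T}_{\mathbf{a}})$ is the group of all automorphisms of the underlying tree that preserve labels, with the topology of pointwise convergence on vertices. All labellings are assumed normal: $\lambda$ is surjective and $\mathrm{Aut}(\mathcal{T}_{\mathbf{a}})$ is transitive on each $\lambda^{-1}(i)$, $i\in C$. $\mathrm{Aut}^+(\mathcal{T}_{\mathbf{a}})$ is the closed subgroup of $\mathrm{Aut}(\mathcal{T}_{\mathbf{a}})$ generated by the subgroups $\mathrm{Fix}(\{u,v\})=\{g\in\mathrm{Aut}(\mathcal{T}_{\mathbf{a}}):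 g(u)=u,\ g(v)=v\}$, where $\{u,v\}$ ranges over all edges of $\mathcal{T}_{\mathbf{a}}$; it carries the subspace topology.
   Formalization: The topological group G is assumed to be Hausdorff; without this the claim fails, e.g. for the trivial homomorphism into the group of order 2 with the indiscrete topology, whose range is not closed. *)

theory Defs
  imports
    "HOL-Library.Multiset"
    "HOL-Algebra.Group"
    "HOL-Analysis.Function_Topology"
    "HOL-Analysis.Product_Topology"
    "HOL-Analysis.T1_Spaces"
begin

text \<open>
  A graph is given by its adjacency relation; the vertex set is the whole type \<open>'v\<close>.
\<close>

definition nbrs :: "('v \<Rightarrow> 'v \<Rightarrow> bool) \<Rightarrow> 'v \<Rightarrow> 'v set" where
  "nbrs adj v = {w. adj v w}"

definition is_cycle :: "('v \<Rightarrow> 'v \<Rightarrow> bool) \<Rightarrow> 'v list \<Rightarrow> bool" where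
  "is_cycle adj xs \<longleftrightarrow>
     length xs \<ge> 3 \<and> distinct xs \<and> successively adj xs \<and> adj (last xs) (hd xs)"

locale infinite_tree =
  fixes adj :: "'v \<Rightarrow> 'v \<Rightarrow> bool"
  assumes adj_sym: "adj u v \<Longrightarrow> adj v u"
    and adj_irrefl: "\<not> adj v v"
    and tree_connected: "adj\<^sup>*\<^sup>* u v"
    and tree_acyclic: "\<not> is_cycle adj xs"
    and infinite_vertices: "infinite (UNIV :: 'v set)"
    and locally_finite: "finite (nbrs adj v)"
    and degree_gt_1: "card (nbrs adj v) > 1"

text \<open>
  A subgraph of a tree that is itself a tree contains every edge of the ambient tree
  between two of its vertices, so a subtree is identified with its vertex set.
\<close>

definition is_subtree :: "('v \<Rightarrow> 'v \<Rightarrow> bool) \<Rightarrow> 'v set \<Rightarrow> bool" where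
  "is_subtree adj A \<longleftrightarrow> (\<forall>u\<in>A. \<forall>v\<in>A. (\<lambda>x y. x \<in> A \<and> y \<in> A \<and> adj x y)\<^sup>*\<^sup>* u v)"

definition is_ray :: "('v \<Rightarrow> 'v \<Rightarrow> bool) \<Rightarrow> (nat \<Rightarrow> 'v) \<Rightarrow> bool" where
  "is_ray adj r \<longleftrightarrow> inj r \<and> (\<forall>n. adj (r n) (r (Suc n)))"

text \<open>
  As for subtrees, the intersection of two rays of a tree is determined by its vertex set.
\<close>

definition ray_equiv :: "('v \<Rightarrow> 'v \<Rightarrow> bool) \<Rightarrow> ((nat \<Rightarrow> 'v) \<times> (nat \<Rightarrow> 'v)) set" where
  "ray_equiv adj =
     {(r, s). is_ray adj r \<and> is_ray adj s \<and> (\<exists>t. is_ray adj t \<and> range r \<inter> range s = range t)}"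

definition tree_ends :: "('v \<Rightarrow> 'v \<Rightarrow> bool) \<Rightarrow> (nat \<Rightarrow> 'v) set set" where
  "tree_ends adj = {r. is_ray adj r} // ray_equiv adj"

definition aut_group :: "('v \<Rightarrow> 'v \<Rightarrow> bool) \<Rightarrow> ('v \<Rightarrow> 'c) \<Rightarrow> ('v \<Rightarrow> 'v) monoid" where
  "aut_group adj lab =
     \<lparr>carrier = {g. bij g \<and> (\<forall>u v. adj (g u) (g v) \<longleftrightarrow> adj u v) \<and> (\<forall>v. lab (g v) = lab v)},
      mult = (\<circ>), one = id\<rparr>"

text \<open>
  The set of labels is the whole type \<open>'c\<close>.  The last two assumptions say that the
  labelling is normal.
\<close>

locale label_regular_tree = infinite_tree adj
  for adj :: "'v \<Rightarrow> 'v \<Rightarrow> bool" +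
  fixes lab :: "'v \<Rightarrow> 'c"
  assumes label_regular:
      "lab v = lab w \<Longrightarrow>
         image_mset lab (mset_set (nbrs adj v)) = image_mset lab (mset_set (nbrs adj w))"
    and lab_surj: "surj lab"
    and lab_transitive: "lab v = lab w \<Longrightarrow> \<exists>g \<in> carrier (aut_group adj lab). g v = w"

definition aut_topology :: "('v \<Rightarrow> 'v \<Rightarrow> bool) \<Rightarrow> ('v \<Rightarrow> 'c) \<Rightarrow> ('v \<Rightarrow> 'v) topology" where
  "aut_topology adj lab =
     subtopology (product_topology (\<lambda>_. discrete_topology UNIV) UNIV) (carrier (aut_group adj lab))"

definition edge_fix :: "('v \<Rightarrow> 'v \<Rightarrow> bool) \<Rightarrow> ('v \<Rightarrow> 'c) \<Rightarrow> 'v \<Rightarrow> 'v \<Rightarrow> ('v \<Rightarrow> 'v) set" where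
  "edge_fix adj lab u v = {g \<in> carrier (aut_group adj lab). g u = u \<and> g v = v}"

definition aut_plus :: "('v \<Rightarrow> 'v \<Rightarrow> bool) \<Rightarrow> ('v \<Rightarrow> 'c) \<Rightarrow> ('v \<Rightarrow> 'v) set" where
  "aut_plus adj lab =
     (\<lambda>H. subgroup H (aut_group adj lab) \<and> closedin (aut_topology adj lab) H)
       hull (\<Union>{edge_fix adj lab u v | u v. adj u v})"

definition aut_plus_group :: "('v \<Rightarrow> 'v \<Rightarrow> bool) \<Rightarrow> ('v \<Rightarrow> 'c) \<Rightarrow> ('v \<Rightarrow> 'v) monoid" where
  "aut_plus_group adj lab = (aut_group adj lab)\<lparr>carrier := aut_plus adj lab\<rparr>"

definition aut_plus_topology :: "('v \<Rightarrow> 'v \<Rightarrow> bool) \<Rightarrow> ('v \<Rightarrow> 'c) \<Rightarrow> ('v \<Rightarrow> 'v) topology" where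
  "aut_plus_topology adj lab = subtopology (aut_topology adj lab) (aut_plus adj lab)"

text \<open>
  Topological groups are Hausdorff by convention; without this, ranges of continuous
  homomorphisms need not be closed for trivial reasons (indiscrete groups).
\<close>

locale topological_group = group G for G (structure) +
  fixes X :: "'g topology"
  assumes topspace_eq: "topspace X = carrier G"
    and continuous_mult: "continuous_map (prod_topology X X) X (\<lambda>(x, y). x \<otimes> y)"
    and continuous_inv: "continuous_map X X (\<lambda>x. inv x)"
    and Hausdorff: "Hausdorff_space X"

lemma group_aut_group: "group (aut_group adj lab)"
proof (rule groupI)
  fix g assume g: "g \<in> carrier (aut_group adj lab)"
  then have b: "bij g" and a: "\<And>u v. adj (g u) (g v) \<longleftrightarrow> adj u v"
    and l: "\<And>v. lab (g v) = lab v"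
    by (auto simp: aut_group_def)
  let ?h = "Hilbert_Choice.inv g"
  have gh: "g (?h x) = x" for x
    using b by (simp add: bij_is_surj surj_f_inv_f)
  have "adj (?h u) (?h v) \<longleftrightarrow> adj u v" for u v
    using a[of "?h u" "?h v"] by (simp add: gh)
  moreover have "lab (?h v) = lab v" for v
    using l[of "?h v"] by (simp add: gh)
  ultimately have "?h \<in> carrier (aut_group adj lab)"
    using b by (simp add: aut_group_def bij_imp_bij_inv)
  moreover have "?h \<circ> g = id"
    using b by (simp add: bij_is_inj)
  ultimately show "\<exists>h\<in>carrier (aut_group adj lab). h \<otimes>\<^bsub>aut_group adj lab\<^esub> g = \<one>\<^bsub>aut_group adj lab\<^esub>"
    by (auto simp: aut_group_def)
qed (auto simp: aut_group_def bij_comp comp_assoc)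

lemma topspace_aut_topology: "topspace (aut_topology adj lab) = carrier (aut_group adj lab)"
  by (simp add: aut_topology_def)

lemma aut_plus_closed_subgroup:
  "subgroup (aut_plus adj lab) (aut_group adj lab) \<and> closedin (aut_topology adj lab) (aut_plus adj lab)"
proof -
  interpret A: group "aut_group adj lab" by (rule group_aut_group)
  let ?P = "\<lambda>H. subgroup H (aut_group adj lab) \<and> closedin (aut_topology adj lab) H"
  let ?S = "\<Union>{edge_fix adj lab u v | u v. adj u v}"
  have "?P (carrier (aut_group adj lab))"
    using A.subgroup_self closedin_topspace[of "aut_topology adj lab"]
    by (simp add: topspace_aut_topology)
  moreover have "?S \<subseteq> carrier (aut_group adj lab)"
    by (auto simp: edge_fix_def)
  ultimately have ne: "{H. ?P H \<and> ?S \<subseteq> H} \<noteq> {}"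
    by blast
  have "subgroup (\<Inter>{H. ?P H \<and> ?S \<subseteq> H}) (aut_group adj lab)"
    using ne by (intro A.subgroups_Inter) auto
  moreover have "closedin (aut_topology adj lab) (\<Inter>{H. ?P H \<and> ?S \<subseteq> H})"
    using ne by (intro closedin_Inter) auto
  ultimately show ?thesis
    by (simp add: aut_plus_def hull_def)
qed

lemma group_aut_plus_group: "group (aut_plus_group adj lab)"
  unfolding aut_plus_group_def
  using aut_plus_closed_subgroup group_aut_group by (metis subgroup.subgroup_is_group)

end

theory Submission
  imports Defs
begin

text \<open>
  Call a half-tree \<open>D\<close> (one side of an edge) \<^emph>\<open>essential\<close> if some element of
  \<open>H = Aut\<^sup>+\<close> that moves only vertices of \<open>D\<close> has a non-trivial image under \<open>\<phi>\<close>.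
  The proof needs only two disjoint essential half-trees \<open>D\<close> and \<open>E\<close>.

  Given them, let \<open>g\<close> be in the closure of the range and let \<open>u\<close> witness that \<open>D\<close> is essential.
  If \<open>\<phi> h\<close> is close to \<open>g\<close>, then \<open>\<phi> (h u h\<inverse>)\<close> is close to \<open>g \<phi>(u) g\<inverse> \<noteq> 1\<close>, so by continuity
  \<open>h u h\<inverse>\<close> moves a vertex of some fixed finite set; that is, \<open>h D\<close> meets this set
  (\<open>essential_halftree_recurrence\<close>).  The same holds for \<open>h E\<close>.  As \<open>h D\<close> and \<open>h E\<close> are disjoint,
  the edge that bounds \<open>h D\<close> lies on a path between two such vertices, which leaves only
  finitely many possibilities for it (\<open>locally_bounded_preimage\<close>).  By local finiteness such \<open>h\<close>
  form a compact set, and so \<open>g\<close> is in the range (\<open>closed_range_of_disjoint_pair\<close>).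

  If \<open>\<phi>\<close> kills all automorphisms that fix an edge, then it is trivial, since its kernel is a closed
  subgroup.  Otherwise there is an essential half-tree: an automorphism fixing an edge is a product
  of two automorphisms, each supported on one side of this edge
  (\<open>essential_halftrees_nonempty\<close>).

  That two of them are disjoint is \<open>disjoint_halftrees_in_invariant_family\<close>.  Suppose that any two
  essential half-trees meet, and consider all translates \<open>a D\<close> of essential half-trees by elements
  \<open>a\<close> of the full automorphism group.  If any two of these translates meet, then their
  intersection is an invariant proper subtree, or else it is empty and from every vertex they
  all point in the direction of one and the same end, which is then invariant.  If two of them are
  disjoint, then there is a half-tree \<open>D\<close> such that \<open>D\<close> and its complement are both translates of
  essential half-trees.  For \<open>g\<close> fixing an edge, \<open>g D\<close> then meets \<open>D\<close> and the same holds for the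
  complements, so \<open>D\<close> and \<open>g D\<close> are nested, and as \<open>g\<close> has a fixed vertex they are equal.  Hence all
  such \<open>g\<close> fix the edge bounding \<open>D\<close>.  Their common fixed vertices form a non-empty invariant
  subtree, which must be the whole tree, and there is no non-trivial \<open>g\<close> at all.
\<close>

section \<open>Half-trees\<close>

text \<open>
  Describing half-trees through connectedness of both sides, without mention of the edge that
  bounds them, makes complements and images under automorphisms immediate.
\<close>

definition halftree :: "('v \<Rightarrow> 'v \<Rightarrow> bool) \<Rightarrow> 'v set \<Rightarrow> bool" where
  "halftree adj D \<longleftrightarrow> D \<noteq> {} \<and> D \<noteq> UNIV \<and> is_subtree adj D \<and> is_subtree adj (- D)"

lemma halftree_Compl [simp]: "halftree adj (- D) \<longleftrightarrow> halftree adj D"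
  by (auto simp: halftree_def)

lemma rtranclp_crossing:
  assumes "R\<^sup>*\<^sup>* a b" "a \<in> D" "b \<notin> D"
  shows "\<exists>x y. R x y \<and> x \<in> D \<and> y \<notin> D"
  using assms by (induction rule: rtranclp_induct) blast+

lemma subtree_crossing:
  assumes "is_subtree adj S" "a \<in> S" "b \<in> S" "a \<in> D" "b \<notin> D"
  obtains x y where "x \<in> S" "y \<in> S" "adj x y" "x \<in> D" "y \<notin> D"
  using assms rtranclp_crossing[of "\<lambda>x y. x \<in> S \<and> y \<in> S \<and> adj x y" a b D]
  unfolding is_subtree_def by blast

lemma rtranclp_simple_path:
  assumes "R\<^sup>*\<^sup>* u v"
  obtains xs where "xs \<noteq> []" "hd xs = u" "last xs = v" "distinct xs" "successively R xs"
proof -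
  have "\<exists>xs. xs \<noteq> [] \<and> hd xs = u \<and> last xs = v \<and> distinct xs \<and> successively R xs"
    using assms
  proof (induction rule: converse_rtranclp_induct)
    case base
    show ?case by (rule exI[of _ "[v]"]) simp
  next
    case (step x y)
    then obtain xs where xs: "xs \<noteq> []" "hd xs = y" "last xs = v" "distinct xs" "successively R xs"
      by blast
    show ?case
    proof (cases "x \<in> set xs")
      case True
      then obtain ys zs where eq: "xs = ys @ x # zs"
        by (auto simp: in_set_conv_decomp)
      with xs have "last (x # zs) = v" "distinct (x # zs)" "successively R (x # zs)"
        by (auto simp: successively_append_iff)
      then show ?thesis by (intro exI[of _ "x # zs"]) simp
    next
      case False
      with xs step(1) show ?thesis
        by (intro exI[of _ "x # xs"]) (auto simp: successively_Cons)
    qed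
  qed
  then show ?thesis using that by blast
qed

lemma successively_in_subset:
  assumes "successively (\<lambda>x y. x \<in> S \<and> y \<in> S \<and> R x y) xs" "xs \<noteq> []" "hd xs \<in> S"
  shows "set xs \<subseteq> S" "successively R xs"
  using assms by (induction xs rule: induct_list012) auto

context infinite_tree
begin

text \<open>
  Two different edges between \<open>D\<close> and its complement would close up to a cycle through a simple
  path in \<open>D\<close> and one in the complement.
\<close>

lemma cut_edge_unique:
  assumes D: "halftree adj D"
    and ab: "adj a b" "a \<in> D" "b \<notin> D" and ab': "adj a' b'" "a' \<in> D" "b' \<notin> D"
  shows "a' = a \<and> b' = b"
proof (rule ccontr)
  assume ne: "\<not> (a' = a \<and> b' = b)"
  have "(\<lambda>x y. x \<in> D \<and> y \<in> D \<and> adj x y)\<^sup>*\<^sup>* a a'"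
    using D ab ab' by (auto simp: halftree_def is_subtree_def)
  then obtain xs where xs: "xs \<noteq> []" "hd xs = a" "last xs = a'" "distinct xs"
    "successively (\<lambda>x y. x \<in> D \<and> y \<in> D \<and> adj x y) xs"
    by (rule rtranclp_simple_path)
  have "(\<lambda>x y. x \<in> - D \<and> y \<in> - D \<and> adj x y)\<^sup>*\<^sup>* b' b"
    using D ab ab' unfolding halftree_def is_subtree_def by blast
  then obtain ys where ys: "ys \<noteq> []" "hd ys = b'" "last ys = b" "distinct ys"
    "successively (\<lambda>x y. x \<in> - D \<and> y \<in> - D \<and> adj x y) ys"
    by (rule rtranclp_simple_path)
  have xs': "set xs \<subseteq> D" "successively adj xs"
    using successively_in_subset[OF xs(5,1)] xs(2) ab by auto
  have ys': "set ys \<subseteq> - D" "successively adj ys"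
    using successively_in_subset[OF ys(5,1)] ys(2) ab' by auto
  have "length (xs @ ys) \<ge> 3"
  proof (rule ccontr)
    assume "\<not> length (xs @ ys) \<ge> 3"
    with xs(1) ys(1) have "length xs = 1" "length ys = 1"
      by (auto simp flip: length_greater_0_conv)
    then obtain x y where "xs = [x]" "ys = [y]"
      by (auto simp: length_Suc_conv)
    with xs ys ne show False by simp
  qed
  moreover have "distinct (xs @ ys)"
    using xs(4) ys(4) xs'(1) ys'(1) by auto
  moreover have "successively adj (xs @ ys)"
    using xs ys xs' ys' ab' by (simp add: successively_append_iff)
  moreover have "adj (last (xs @ ys)) (hd (xs @ ys))"
    using xs ys ab adj_sym by simp
  ultimately have "is_cycle adj (xs @ ys)"
    unfolding is_cycle_def by blast
  then show False using tree_acyclic by blast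
qed

lemma cut_edge_exists:
  assumes "halftree adj D"
  obtains x y where "adj x y" "x \<notin> D" "y \<in> D"
proof -
  from assms obtain a b where "a \<in> D" "b \<notin> D"
    by (auto simp: halftree_def)
  then show ?thesis
    using rtranclp_crossing[OF tree_connected, of a D b] adj_sym that by blast
qed

text \<open>
  Being connected and avoiding \<open>x\<close>, the half-tree \<open>D\<close> cannot leave \<open>E\<close>, because the only way out
  of \<open>E\<close> is the edge from \<open>y\<close> to \<open>x\<close>; and vice versa.
\<close>

lemma halftree_eqI:
  assumes D: "halftree adj D" and E: "halftree adj E"
    and "adj x y" "y \<in> D" "x \<notin> D" "y \<in> E" "x \<notin> E"
  shows "D = E"
proof -
  have sub: "D \<subseteq> E" if D: "halftree adj D" and E: "halftree adj E"
    and e: "adj x y" "y \<in> D" "x \<notin> D" "y \<in> E" "x \<notin> E" for D E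
  proof (rule ccontr)
    assume "\<not> D \<subseteq> E"
    then obtain p where p: "p \<in> D" "p \<notin> E" by blast
    obtain a b where ab: "a \<in> D" "b \<in> D" "adj a b" "a \<in> E" "b \<notin> E"
      using D e p subtree_crossing[of adj D y p E] unfolding halftree_def by metis
    then have "b = x" using cut_edge_unique[OF E adj_sym[OF e(1)] e(4,5)] by blast
    with ab e show False by simp
  qed
  show ?thesis using sub[of D E] sub[of E D] assms by blast
qed

text \<open>
  If all four corners were non-empty, both \<open>D\<close> and its complement would contain an edge crossing
  the boundary of \<open>E\<close>, but there is only one such edge.
\<close>

lemma halftrees_nested:
  assumes D: "halftree adj D" and E: "halftree adj E"
    and "D \<inter> E \<noteq> {}" "- D \<inter> - E \<noteq> {}"
  shows "D \<subseteq> E \<or> E \<subseteq> D"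
proof (rule ccontr)
  assume "\<not> ?thesis"
  then obtain p q where pq: "p \<in> D" "p \<notin> E" "q \<in> E" "q \<notin> D" by blast
  from assms obtain r s where rs: "r \<in> D" "r \<in> E" "s \<notin> D" "s \<notin> E" by blast
  obtain a b where ab: "a \<in> D" "b \<in> D" "adj a b" "a \<in> E" "b \<notin> E"
    using D pq rs subtree_crossing[of adj D r p E] unfolding halftree_def by metis
  obtain c d where cd: "c \<in> - D" "d \<in> - D" "adj c d" "c \<in> E" "d \<notin> E"
    using D pq rs subtree_crossing[of adj "- D" q s E] unfolding halftree_def
    by (metis ComplI)
  have "c = a" using cut_edge_unique[OF E ab(3-5) cd(3-5)] by simp
  with ab cd show False by simp
qed

text \<open>
  The half-tree is the component of \<open>v\<close> after deletion of the edge.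
\<close>

lemma halftree_of_edge:
  assumes uv: "adj u v"
  obtains D where "halftree adj D" "v \<in> D" "u \<notin> D"
proof -
  define R where "R = (\<lambda>x y. adj x y \<and> {x, y} \<noteq> {u, v})"
  have Rsym: "R x y \<Longrightarrow> R y x" for x y
    using adj_sym by (auto simp: R_def insert_commute)
  have comp: "is_subtree adj {w. R\<^sup>*\<^sup>* z w}" for z
  proof -
    let ?C = "{w. R\<^sup>*\<^sup>* z w}"
    let ?Q = "\<lambda>x y. x \<in> ?C \<and> y \<in> ?C \<and> adj x y"
    have "symp ?Q" using adj_sym by (auto simp: symp_def)
    then have Qsym: "?Q\<^sup>*\<^sup>* x y \<Longrightarrow> ?Q\<^sup>*\<^sup>* y x" for x y
      by (metis symp_def symp_rtranclp)
    have from_z: "?Q\<^sup>*\<^sup>* z w" if "R\<^sup>*\<^sup>* z w" for w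
      using that
    proof (induction rule: rtranclp_induct)
      case (step y w)
      then have "R\<^sup>*\<^sup>* z w" "adj y w"
        using rtranclp.rtrancl_into_rtrancl[of R z y w] by (auto simp: R_def)
      with step.hyps have "?Q y w" by blast
      with step.IH show ?case by (rule rtranclp.rtrancl_into_rtrancl)
    qed simp
    show ?thesis
      unfolding is_subtree_def using from_z Qsym by (blast intro: rtranclp_trans)
  qed
  have not_vu: "\<not> R\<^sup>*\<^sup>* v u"
  proof
    assume "R\<^sup>*\<^sup>* v u"
    then obtain xs where xs: "xs \<noteq> []" "hd xs = v" "last xs = u" "distinct xs" "successively R xs"
      by (rule rtranclp_simple_path)
    have "successively adj xs"
      using xs(5) by (rule successively_mono) (auto simp: R_def)
    moreover have "length xs \<ge> 3"
    proof (rule ccontr)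
      assume "\<not> length xs \<ge> 3"
      moreover have "u \<noteq> v" using uv adj_irrefl by blast
      moreover from xs(1,2) obtain ys where "xs = v # ys" by (cases xs) auto
      ultimately obtain a where "xs = [v] \<or> xs = [v, a]"
        by (cases ys; cases "tl ys") auto
      then show False using xs(3,5) \<open>u \<noteq> v\<close> by (auto simp: R_def)
    qed
    ultimately have "is_cycle adj xs"
      using xs uv by (simp add: is_cycle_def)
    then show False using tree_acyclic by blast
  qed
  have cover: "R\<^sup>*\<^sup>* v w \<or> R\<^sup>*\<^sup>* u w" for w
    using tree_connected[of v w]
  proof (induction rule: rtranclp_induct)
    case (step y z)
    show ?case
    proof (cases "R y z")
      case True
      with step.IH show ?thesis by (blast intro: rtranclp.rtrancl_into_rtrancl)
    next
      case False
      with step.hyps have "z = u \<or> z = v" by (auto simp: R_def doubleton_eq_iff)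
      then show ?thesis by blast
    qed
  qed simp
  have disj: "\<not> (R\<^sup>*\<^sup>* v w \<and> R\<^sup>*\<^sup>* u w)" for w
  proof
    assume "R\<^sup>*\<^sup>* v w \<and> R\<^sup>*\<^sup>* u w"
    moreover have "symp R\<^sup>*\<^sup>*" using Rsym by (intro symp_rtranclp) (auto simp: symp_def)
    ultimately have "R\<^sup>*\<^sup>* v u" by (metis rtranclp_trans symp_def)
    with not_vu show False by blast
  qed
  have "- {w. R\<^sup>*\<^sup>* v w} = {w. R\<^sup>*\<^sup>* u w}" using cover disj by blast
  then have "halftree adj {w. R\<^sup>*\<^sup>* v w}"
    using comp[of v] comp[of u] not_vu by (auto simp: halftree_def)
  with not_vu show ?thesis by (intro that) auto
qed

text \<open>
  The vertex \<open>w\<close> is the first step of the path from \<open>u\<close> to \<open>v\<close>.  Such a first step exists because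
  the half-trees pointing away from \<open>u\<close>, together with \<open>u\<close> itself, are closed under adjacency.
\<close>

lemma next_vertex:
  assumes "u \<noteq> v"
  obtains w E where "adj u w" "halftree adj E" "w \<in> E" "v \<in> E" "u \<notin> E"
proof -
  have "v = u \<or> (\<exists>w E. adj u w \<and> halftree adj E \<and> w \<in> E \<and> v \<in> E \<and> u \<notin> E)"
    using tree_connected[of u v]
  proof (induction rule: rtranclp_induct)
    case (step y z)
    show ?case
    proof (cases "y = u")
      case True
      with step.hyps show ?thesis using halftree_of_edge[of u z] by metis
    next
      case False
      with step.IH obtain w E
        where E: "adj u w" "halftree adj E" "w \<in> E" "y \<in> E" "u \<notin> E" by blast
      show ?thesis
        using cut_edge_unique[OF E(2) adj_sym[OF E(1)] E(3,5) step.hyps(2)] E by blast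
    qed
  qed simp
  with assms that show ?thesis by blast
qed

lemma halftree_contains_path:
  assumes "halftree adj E" "adj u w" "w \<in> E" "u \<notin> E"
    and "successively adj xs" "xs \<noteq> []" "hd xs \<in> E" "u \<notin> set xs"
  shows "set xs \<subseteq> E"
  using assms(5-8)
proof (induction xs)
  case (Cons x xs)
  show ?case
  proof (cases xs)
    case (Cons y ys)
    then have "adj x y" using Cons.prems by simp
    then have "y \<in> E"
      using cut_edge_unique[OF assms(1) adj_sym[OF assms(2)] assms(3,4), of x y] Cons.prems Cons
      by auto
    with Cons Cons.IH Cons.prems show ?thesis by (auto simp: successively_Cons)
  qed (use Cons.prems in simp)
qed simp

text \<open>
  A convexity criterion: it suffices that \<open>S\<close> contains the first step \<open>w\<close> of the path between any
  two of its vertices.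
\<close>

lemma subtreeI:
  assumes step: "\<And>u v w E. \<lbrakk>u \<in> S; v \<in> S; adj u w; halftree adj E; w \<in> E; v \<in> E; u \<notin> E\<rbrakk> \<Longrightarrow> w \<in> S"
  shows "is_subtree adj S"
  unfolding is_subtree_def
proof (intro ballI)
  let ?Q = "\<lambda>x y. x \<in> S \<and> y \<in> S \<and> adj x y"
  fix u v assume uv: "u \<in> S" "v \<in> S"
  obtain xs where xs: "xs \<noteq> []" "hd xs = u" "last xs = v" "distinct xs" "successively adj xs"
    using tree_connected[of u v] by (rule rtranclp_simple_path)
  then show "?Q\<^sup>*\<^sup>* u v"
    using uv(1)
  proof (induction xs arbitrary: u)
    case (Cons x xs)
    show ?case
    proof (cases xs)
      case Nil
      with Cons.prems show ?thesis by simp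
    next
      case (Cons w ys)
      from Cons.prems Cons have uw: "adj u w" by simp
      obtain E where E: "halftree adj E" "w \<in> E" "u \<notin> E"
        using halftree_of_edge[OF uw] .
      have "set xs \<subseteq> E"
        using halftree_contains_path[OF E(1) uw E(2,3), of xs] Cons.prems Cons E by auto
      moreover have "v \<in> set xs" using Cons.prems Cons by auto
      ultimately have "w \<in> S" using step[OF _ uv(2) uw E(1,2) _ E(3)] Cons.prems by blast
      moreover have "?Q\<^sup>*\<^sup>* w v"
        using Cons.IH[of w] Cons.prems Cons \<open>w \<in> S\<close> by simp
      moreover have "?Q u w" using Cons.prems uw \<open>w \<in> S\<close> by blast
      ultimately show ?thesis by (metis (no_types, lifting) converse_rtranclp_into_rtranclp)
    qed
  qed simp
qed

text \<open>
  Suppose that the first step \<open>w\<close> from \<open>u\<close> to \<open>v\<close> were outside a member \<open>D\<close>.  As \<open>D\<close> is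
  connected and contains \<open>u\<close> and \<open>v\<close>, it contains both ends of an edge separating \<open>v\<close> from \<open>u\<close> just
  after \<open>u\<close>; but this edge ends in \<open>w\<close>.
\<close>

lemma subtree_Inter_halftrees:
  assumes "\<And>D. D \<in> \<D> \<Longrightarrow> halftree adj D"
  shows "is_subtree adj (\<Inter>\<D>)"
proof (rule subtreeI, rule InterI, rule ccontr)
  fix u v w E D
  assume u: "u \<in> \<Inter>\<D>" and v: "v \<in> \<Inter>\<D>" and uw: "adj u w"
    and E: "halftree adj E" "w \<in> E" "v \<in> E" "u \<notin> E" and D: "D \<in> \<D>" "w \<notin> D"
  obtain a b where "a \<in> D" "b \<in> D" "adj a b" "a \<in> E" "b \<notin> E"
    using subtree_crossing[of adj D v u E] assms[OF D(1)] u v D E unfolding halftree_def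
    by (metis InterD)
  moreover have "a = w"
    using cut_edge_unique[OF E(1) adj_sym[OF uw] E(2,4)] calculation by blast
  ultimately show False using D by simp
qed

end


section \<open>Pairwise intersecting half-trees point to a subtree or to an end\<close>

lemma aut_groupD:
  assumes "g \<in> carrier (aut_group adj lab)"
  shows "bij g" "adj (g u) (g v) \<longleftrightarrow> adj u v" "lab (g v) = lab v"
  using assms by (auto simp: aut_group_def)

lemma aut_group_inv:
  assumes "g \<in> carrier (aut_group adj lab)"
  shows "inv\<^bsub>aut_group adj lab\<^esub> g \<in> carrier (aut_group adj lab)"
    and "(inv\<^bsub>aut_group adj lab\<^esub> g) (g v) = v" and "g ((inv\<^bsub>aut_group adj lab\<^esub> g) v) = v"
proof -
  interpret A: group "aut_group adj lab" by (rule group_aut_group)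
  show "inv\<^bsub>aut_group adj lab\<^esub> g \<in> carrier (aut_group adj lab)"
    using assms by simp
  show "(inv\<^bsub>aut_group adj lab\<^esub> g) (g v) = v"
    using fun_cong[OF A.l_inv[OF assms], of v] by (simp add: aut_group_def)
  show "g ((inv\<^bsub>aut_group adj lab\<^esub> g) v) = v"
    using fun_cong[OF A.r_inv[OF assms], of v] by (simp add: aut_group_def)
qed

lemma aut_group_mult [simp]: "g \<otimes>\<^bsub>aut_group adj lab\<^esub> h = g \<circ> h"
  and aut_group_one [simp]: "\<one>\<^bsub>aut_group adj lab\<^esub> = id"
  by (simp_all add: aut_group_def)

lemma subtree_image:
  assumes g: "g \<in> carrier (aut_group adj lab)" and S: "is_subtree adj S"
  shows "is_subtree adj (g ` S)"
proof -
  let ?Q = "\<lambda>S x y. x \<in> S \<and> y \<in> S \<and> adj x y"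
  have "(?Q (g ` S))\<^sup>*\<^sup>* (g u) (g v)" if "(?Q S)\<^sup>*\<^sup>* u v" for u v
    using that
  proof (induction rule: rtranclp_induct)
    case (step y z)
    then have "?Q (g ` S) (g y) (g z)" using aut_groupD(2)[OF g] by auto
    with step.IH show ?case by (metis (no_types, lifting) rtranclp.rtrancl_into_rtrancl)
  qed simp
  with S show ?thesis unfolding is_subtree_def by blast
qed

lemma halftree_image:
  assumes g: "g \<in> carrier (aut_group adj lab)" and D: "halftree adj D"
  shows "halftree adj (g ` D)"
proof -
  have "- g ` D = g ` (- D)"
    using aut_groupD(1)[OF g] by (metis bij_image_Compl_eq)
  moreover have "g ` (- D) \<noteq> {}" using D by (auto simp: halftree_def)
  ultimately show ?thesis
    using D subtree_image[OF g] unfolding halftree_def by (metis Compl_UNIV_eq image_is_empty)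
qed

text \<open>
  The half-trees of \<open>\<D>\<close> should be thought of as the neighbourhoods of an end.  The end is
  recovered from the map sending each vertex to its neighbour in the direction of the end.
\<close>

locale meeting_halftrees = infinite_tree adj
  for adj :: "'v \<Rightarrow> 'v \<Rightarrow> bool" +
  fixes \<D> :: "'v set set"
  assumes halftree: "D \<in> \<D> \<Longrightarrow> halftree adj D"
    and meet: "D \<in> \<D> \<Longrightarrow> E \<in> \<D> \<Longrightarrow> D \<inter> E \<noteq> {}"
    and up: "D \<in> \<D> \<Longrightarrow> halftree adj E \<Longrightarrow> D \<subseteq> E \<Longrightarrow> E \<in> \<D>"
    and empty_Inter: "\<Inter>\<D> = {}"
begin

definition toward :: "'v \<Rightarrow> 'v" where
  "toward v = (THE w. adj v w \<and> (\<exists>D\<in>\<D>. v \<notin> D \<and> w \<in> D))"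

text \<open>
  The half-tree behind the first step from \<open>v\<close> to a point of a member of \<open>\<D>\<close> avoiding \<open>v\<close> contains
  this member or is contained in it; in both cases a member of \<open>\<D>\<close> witnesses the step.
\<close>

lemma toward_exists: "\<exists>w D. adj v w \<and> D \<in> \<D> \<and> v \<notin> D \<and> w \<in> D"
proof -
  obtain D where D: "D \<in> \<D>" "v \<notin> D" using empty_Inter by blast
  then obtain p where p: "p \<in> D" using halftree[OF D(1)] by (auto simp: halftree_def)
  with D obtain w E where E: "adj v w" "halftree adj E" "w \<in> E" "p \<in> E" "v \<notin> E"
    by (metis next_vertex)
  have "D \<subseteq> E \<or> E \<subseteq> D"
    using halftrees_nested[OF halftree[OF D(1)] E(2)] p D E by blast
  then show ?thesis using up[OF D(1) E(2)] D E by blast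
qed

lemma toward_unique:
  assumes "adj v w" "D \<in> \<D>" "v \<notin> D" "w \<in> D" and "adj v w'" "E \<in> \<D>" "v \<notin> E" "w' \<in> E"
  shows "w = w'"
proof -
  have "D \<subseteq> E \<or> E \<subseteq> D"
    using halftrees_nested[OF halftree halftree, of D E] meet[of D E] assms by blast
  then show ?thesis
  proof
    assume "D \<subseteq> E"
    then show ?thesis
      using cut_edge_unique[OF halftree[OF assms(6)] adj_sym[OF assms(1)] _ _ adj_sym[OF assms(5)]]
        assms by blast
  next
    assume "E \<subseteq> D"
    then show ?thesis
      using cut_edge_unique[OF halftree[OF assms(2)] adj_sym[OF assms(1)] _ _ adj_sym[OF assms(5)]]
        assms by blast
  qed
qed

lemma toward_eqI:
  assumes "adj v w" "D \<in> \<D>" "v \<notin> D" "w \<in> D"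
  shows "toward v = w"
  unfolding toward_def using assms toward_unique by (intro the_equality) blast+

lemma towardE:
  obtains D where "adj v (toward v)" "D \<in> \<D>" "v \<notin> D" "toward v \<in> D"
  using toward_exists[of v] toward_eqI by metis

lemma adj_toward: "adj v (toward v)"
  by (metis towardE)

text \<open>
  The iteration of \<open>toward\<close> does not turn back: members of \<open>\<D>\<close> witnessing two consecutive steps
  are nested.  This is why the iterates of a vertex form a ray.
\<close>

lemma toward_shrinks:
  assumes D: "D \<in> \<D>" "v \<notin> D" "toward v \<in> D"
    and E: "E \<in> \<D>" "toward v \<notin> E" "toward (toward v) \<in> E"
  shows "E \<subseteq> D" "v \<notin> E"
proof -
  show v: "v \<notin> E"
  proof
    assume "v \<in> E"
    with E(1,2) have "toward (toward v) = v"
      using toward_eqI[OF adj_sym[OF adj_toward]] by blast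
    then have "D = - E"
      using halftree_eqI[OF halftree[OF D(1)], of "- E" v "toward v"] halftree[OF E(1)]
        D E \<open>v \<in> E\<close> adj_toward by simp
    then show False using meet[OF D(1) E(1)] by blast
  qed
  have "D \<subseteq> E \<or> E \<subseteq> D"
    using halftrees_nested[OF halftree halftree, of D E] meet[of D E] v D E by blast
  with D E show "E \<subseteq> D" by blast
qed

text \<open>
  If neither holds, then a member of \<open>\<D>\<close> lies behind \<open>v\<close> as seen from \<open>w\<close>, and another one lies
  behind \<open>w\<close> as seen from \<open>v\<close>; these two are disjoint.
\<close>

lemma toward_edge:
  assumes vw: "adj v w"
  shows "toward v = w \<or> toward w = v"
proof (rule ccontr)
  assume ne: "\<not> ?thesis"
  obtain D where D: "adj v (toward v)" "D \<in> \<D>" "v \<notin> D" "toward v \<in> D" by (rule towardE)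
  obtain E where E: "adj w (toward w)" "E \<in> \<D>" "w \<notin> E" "toward w \<in> E" by (rule towardE)
  have wD: "w \<notin> D" using ne vw D toward_eqI by blast
  have vE: "v \<notin> E" using ne vw E toward_eqI adj_sym by blast
  obtain F where F: "halftree adj F" "w \<in> F" "v \<notin> F" using halftree_of_edge[OF vw] .
  have cut: "a = w \<and> b = v" if "adj a b" "a \<in> F" "b \<notin> F" for a b
    using cut_edge_unique[OF F(1) adj_sym[OF vw] F(2,3) that] .
  have "toward v \<notin> F" using cut[OF adj_sym[OF D(1)]] F ne by blast
  then have "D \<inter> F = {}"
    using subtree_crossing[of adj D _ "toward v" F] halftree[OF D(2)] D(4) cut wD
    unfolding halftree_def by (metis disjoint_iff)
  moreover have "toward w \<in> F" using cut[OF E(1)] F ne by blast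
  then have "E \<subseteq> F"
    using subtree_crossing[of adj E "toward w" _ F] halftree[OF E(2)] E(3,4) cut
    unfolding halftree_def by (metis subsetI)
  ultimately show False using meet[OF D(2) E(2)] by blast
qed

lemma funpow_toward_decreasing:
  assumes "D \<in> \<D>" "v \<notin> D" "toward v \<in> D"
  shows "(toward ^^ Suc n) v \<in> D"
proof -
  have "\<exists>E\<in>\<D>. E \<subseteq> D \<and> (toward ^^ n) v \<notin> E \<and> (toward ^^ Suc n) v \<in> E" for n
  proof (induction n)
    case 0
    show ?case using assms by auto
  next
    case (Suc n)
    then obtain E where E: "E \<in> \<D>" "E \<subseteq> D" "(toward ^^ n) v \<notin> E" "toward ((toward ^^ n) v) \<in> E"
      by auto
    obtain F where F: "F \<in> \<D>" "toward ((toward ^^ n) v) \<notin> F"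
        "toward (toward ((toward ^^ n) v)) \<in> F"
      by (rule towardE[of "toward ((toward ^^ n) v)"])
    have "F \<subseteq> D" using toward_shrinks(1)[OF E(1,3,4) F] E(2) by (rule subset_trans)
    then show ?case using F by (intro bexI[of _ F] conjI) simp_all
  qed
  then show ?thesis by blast
qed

lemma is_ray_toward: "is_ray adj (\<lambda>n. (toward ^^ n) v)"
proof -
  have "(toward ^^ m) v \<noteq> (toward ^^ n) v" if "m < n" for m n
  proof -
    from that obtain k where k: "n = Suc k + m" using less_iff_Suc_add by auto
    obtain D where "D \<in> \<D>" "(toward ^^ m) v \<notin> D" "toward ((toward ^^ m) v) \<in> D"
      by (rule towardE[of "(toward ^^ m) v"])
    then show ?thesis
      using funpow_toward_decreasing[of D "(toward ^^ m) v" k] k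
      by (metis comp_apply funpow_add)
  qed
  then have "inj (\<lambda>n. (toward ^^ n) v)"
    by (rule linorder_injI)
  then show ?thesis using adj_toward by (simp add: is_ray_def)
qed

lemma funpow_toward_merge: "\<exists>i j. (toward ^^ i) v = (toward ^^ j) w"
  using tree_connected[of v w]
proof (induction rule: rtranclp_induct)
  case base
  show ?case by blast
next
  case (step y z)
  then obtain i j where ij: "(toward ^^ i) v = (toward ^^ j) y" by blast
  from toward_edge[OF step.hyps(2)] show ?case
  proof
    assume z: "toward y = z"
    have "(toward ^^ Suc i) v = (toward ^^ j) z"
      using ij z funpow_swap1[of toward j y] by simp
    then show ?thesis by blast
  next
    assume "toward z = y"
    then have "(toward ^^ i) v = (toward ^^ Suc j) z"
      using ij funpow_swap1[of toward j z] by simp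
    then show ?thesis by blast
  qed
qed

definition limit_end :: "(nat \<Rightarrow> 'v) set" where
  "limit_end = {s. is_ray adj s \<and> (\<forall>n. s (Suc n) = toward (s n))}"

lemma limit_end_iff: "s \<in> limit_end \<longleftrightarrow> (\<forall>n. s n = (toward ^^ n) (s 0))"
proof
  assume "s \<in> limit_end"
  then have s: "s (Suc n) = toward (s n)" for n by (simp add: limit_end_def)
  have "s n = (toward ^^ n) (s 0)" for n by (induction n) (simp_all add: s)
  then show "\<forall>n. s n = (toward ^^ n) (s 0)" by blast
next
  assume s: "\<forall>n. s n = (toward ^^ n) (s 0)"
  then have "s = (\<lambda>n. (toward ^^ n) (s 0))" by blast
  then have "is_ray adj s" by (rule ssubst) (rule is_ray_toward)
  moreover have "s (Suc n) = toward (s n)" for n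
    using spec[OF s, of n] spec[OF s, of "Suc n"] by simp
  ultimately show "s \<in> limit_end" by (simp add: limit_end_def)
qed

text \<open>
  A ray belongs to the end exactly if all its steps are along \<open>toward\<close>.  For if one step is not, then
  by \<open>toward_edge\<close> all later steps are directly opposite to \<open>toward\<close>, so the ray moves away from
  the end and meets the forward orbit of \<open>v\<close> only finitely often.
\<close>

lemma limit_end_class: "ray_equiv adj `` {\<lambda>n. (toward ^^ n) v} = limit_end"
proof (intro equalityI subsetI)
  let ?r = "\<lambda>n. (toward ^^ n) v"
  fix s assume "s \<in> limit_end"
  then have s: "s n = (toward ^^ n) (s 0)" for n using limit_end_iff[of s] by blast
  define i where "i = (LEAST i. ?r i \<in> range s)"
  have "\<exists>i. ?r i \<in> range s"
  proof -
    obtain i j where "?r i = (toward ^^ j) (s 0)" using funpow_toward_merge by blast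
    then have "?r i = s j" using s[of j] by simp
    then show ?thesis by (metis rangeI)
  qed
  then have i: "?r i \<in> range s" "\<And>j. ?r j \<in> range s \<Longrightarrow> i \<le> j"
    unfolding i_def by (auto intro: LeastI Least_le)
  from i(1) obtain j where j: "?r i = s j" by blast
  have "range ?r \<inter> range s = range (\<lambda>n. (toward ^^ n) (?r i))"
  proof (intro equalityI subsetI)
    fix x assume "x \<in> range ?r \<inter> range s"
    then obtain k where k: "x = ?r k" "i \<le> k" using i(2) by auto
    then have "x = (toward ^^ (k - i)) (?r i)"
      by (metis comp_apply funpow_add le_add_diff_inverse2)
    then show "x \<in> range (\<lambda>n. (toward ^^ n) (?r i))" by blast
  next
    fix x assume "x \<in> range (\<lambda>n. (toward ^^ n) (?r i))"
    then obtain n where n: "x = (toward ^^ n) (?r i)" by blast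
    then have "x = ?r (n + i)" by (simp add: funpow_add)
    moreover have "x = s (n + j)"
      using n j s[of j] s[of "n + j"] by (simp add: funpow_add)
    ultimately show "x \<in> range ?r \<inter> range s" by blast
  qed
  moreover have "is_ray adj s" using \<open>s \<in> limit_end\<close> by (simp add: limit_end_def)
  ultimately show "s \<in> ray_equiv adj `` {?r}"
    using is_ray_toward unfolding ray_equiv_def by blast
next
  let ?r = "\<lambda>n. (toward ^^ n) v"
  fix s assume "s \<in> ray_equiv adj `` {?r}"
  then obtain t where s: "is_ray adj s" and t: "is_ray adj t" "range ?r \<inter> range s = range t"
    unfolding ray_equiv_def by blast
  have "s (Suc n) = toward (s n)" for n
  proof (rule ccontr)
    assume away: "s (Suc n) \<noteq> toward (s n)"
    have backward: "toward (s (Suc (n + k))) = s (n + k)" for k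
    proof (induction k)
      case 0
      show ?case using toward_edge[of "s n" "s (Suc n)"] away s by (auto simp: is_ray_def)
    next
      case (Suc k)
      have "s (Suc (Suc (n + k))) \<noteq> s (n + k)"
        using s by (auto simp: is_ray_def dest!: injD)
      with Suc toward_edge[of "s (Suc (n + k))" "s (Suc (Suc (n + k)))"] s
      show ?case by (auto simp: is_ray_def)
    qed
    have down: "(toward ^^ k) (s (n + k)) = s n" for k
      by (induction k) (simp_all add: backward funpow_Suc_right del: funpow.simps(2))
    have inj_r: "inj ?r" using is_ray_toward by (simp add: is_ray_def)
    have "\<exists>c. \<forall>k j. s (n + k) = ?r j \<longrightarrow> k \<le> c"
    proof (cases "s n \<in> range ?r")
      case True
      then obtain c where c: "s n = ?r c" by blast
      have "k \<le> c" if "s (n + k) = ?r j" for k j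
      proof -
        have "?r c = ?r (k + j)" using down[of k] c that by (simp add: funpow_add)
        then have "c = k + j" using inj_r by (metis injD)
        then show ?thesis by simp
      qed
      then show ?thesis by blast
    next
      case False
      have "s (n + k) \<noteq> ?r j" for k j
        using down[of k] False by (metis comp_apply funpow_add rangeI)
      then show ?thesis by blast
    qed
    then obtain c where c: "\<And>k j. s (n + k) = ?r j \<Longrightarrow> k \<le> c" by blast
    have "range t \<subseteq> s ` {..n + c}"
    proof
      fix x assume "x \<in> range t"
      then obtain m j where m: "x = s m" "x = ?r j" using t(2) by blast
      show "x \<in> s ` {..n + c}"
      proof (cases "m \<le> n")
        case False
        then have "m - n \<le> c" using c[of "m - n" j] m by simp
        with m show ?thesis by auto
      qed (use m in auto)
    qed
    then have "finite (range t)" by (rule finite_subset) simp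
    then show False using t(1) by (auto simp: is_ray_def dest: finite_imageD)
  qed
  with s show "s \<in> limit_end" by (simp add: limit_end_def)
qed

lemma limit_end_in_tree_ends: "limit_end \<in> tree_ends adj"
  unfolding tree_ends_def limit_end_class[symmetric, of undefined]
  using is_ray_toward[of undefined] by (intro quotientI) simp

lemma toward_equivariant:
  assumes g: "g \<in> carrier (aut_group adj lab)" and inv: "\<And>D. D \<in> \<D> \<Longrightarrow> g ` D \<in> \<D>"
  shows "toward (g v) = g (toward v)"
proof -
  obtain D where D: "adj v (toward v)" "D \<in> \<D>" "v \<notin> D" "toward v \<in> D" by (rule towardE)
  have "inj g" using aut_groupD(1)[OF g] by (rule bij_is_inj)
  then show ?thesis
    using toward_eqI[of "g v" "g (toward v)" "g ` D"] inv D aut_groupD(2)[OF g]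
    by (simp add: inj_image_mem_iff)
qed

lemma limit_end_invariant:
  assumes g: "g \<in> carrier (aut_group adj lab)"
    and inv: "\<And>h D. h \<in> carrier (aut_group adj lab) \<Longrightarrow> D \<in> \<D> \<Longrightarrow> h ` D \<in> \<D>"
  shows "(\<lambda>r. g \<circ> r) ` limit_end = limit_end"
proof -
  have sub: "h \<circ> s \<in> limit_end" if "h \<in> carrier (aut_group adj lab)" "s \<in> limit_end" for h s
  proof -
    have "is_ray adj s" "\<And>n. s (Suc n) = toward (s n)"
      using that by (auto simp: limit_end_def)
    moreover have "inj h" using aut_groupD(1)[OF that(1)] by (rule bij_is_inj)
    ultimately show ?thesis
      using aut_groupD(2)[OF that(1)] toward_equivariant[OF that(1) inv[OF that(1)]]
      by (auto simp: limit_end_def is_ray_def intro: inj_compose)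
  qed
  show ?thesis
  proof (intro equalityI subsetI)
    fix s assume s: "s \<in> limit_end"
    have "s = g \<circ> ((inv\<^bsub>aut_group adj lab\<^esub> g) \<circ> s)"
      using aut_group_inv(3)[OF g] by (simp add: fun_eq_iff)
    then show "s \<in> (\<lambda>r. g \<circ> r) ` limit_end"
      using sub[OF aut_group_inv(1)[OF g] s] by (rule image_eqI)
  qed (use sub[OF g] in auto)
qed

end

section \<open>Elliptic automorphisms and half-trees\<close>

context infinite_tree
begin

lemma finite_orbit:
  assumes C: "C \<subseteq> carrier (aut_group adj lab)" and fin: "finite ((\<lambda>g. g v) ` C)"
  shows "finite ((\<lambda>g. g w) ` C)"
  using tree_connected[of v w]
proof (induction rule: rtranclp_induct)
  case base
  show ?case by (rule fin)
next
  case (step y z)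
  have "(\<lambda>g. g z) ` C \<subseteq> (\<Union>x \<in> (\<lambda>g. g y) ` C. nbrs adj x)"
    using step.hyps(2) C aut_groupD(2) by (fastforce simp: nbrs_def)
  moreover have "finite (\<Union>x \<in> (\<lambda>g. g y) ` C. nbrs adj x)"
    using step.IH locally_finite by blast
  ultimately show ?case by (rule finite_subset)
qed

text \<open>
  Let \<open>y\<close> be the vertex of \<open>D\<close> on the edge bounding \<open>D\<close>.  The images of \<open>y\<close> under powers of \<open>g\<close> all
  have the same distance from \<open>v\<close>, so they repeat.  If \<open>g D\<close> were strictly smaller
  than \<open>D\<close>, then \<open>y\<close> would not be in \<open>g D\<close> and no repetition could occur.
\<close>

lemma elliptic_halftree_image_eq:
  assumes g: "g \<in> carrier (aut_group adj lab)" and v: "g v = v"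
    and D: "halftree adj D" and sub: "g ` D \<subseteq> D"
  shows "g ` D = D"
proof -
  obtain x y where xy: "adj x y" "x \<notin> D" "y \<in> D" using D by (rule cut_edge_exists)
  have pow: "g ^^ n \<in> carrier (aut_group adj lab)" "(g ^^ n) v = v" for n
  proof (induction n)
    case 0
    show "g ^^ 0 \<in> carrier (aut_group adj lab)" "(g ^^ 0) v = v" by (simp_all add: aut_group_def)
  next
    case (Suc n)
    show "(g ^^ Suc n) v = v" using Suc v by simp
    have "g ^^ Suc n = g \<otimes>\<^bsub>aut_group adj lab\<^esub> g ^^ n" by simp
    then show "g ^^ Suc n \<in> carrier (aut_group adj lab)"
      using Suc g group.is_monoid[OF group_aut_group] by (metis monoid.m_closed)
  qed
  have "finite ((\<lambda>h. h y) ` range (\<lambda>n. g ^^ n))"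
    by (rule finite_orbit[of _ lab v]) (auto simp: pow image_image)
  then have "\<not> inj (\<lambda>n. (g ^^ n) y)"
    by (auto simp: image_image dest: finite_imageD)
  then obtain i j where ij: "i < j" "(g ^^ i) y = (g ^^ j) y"
    by (metis (no_types, lifting) linorder_injI)
  then obtain k where k: "j = i + Suc k" using less_iff_Suc_add by auto
  have "inj (g ^^ i)" using aut_groupD(1)[OF pow(1)] by (rule bij_is_inj)
  moreover have "(g ^^ i) y = (g ^^ i) ((g ^^ Suc k) y)"
    using ij(2) k by (metis comp_apply funpow_add)
  ultimately have "y = g ((g ^^ k) y)" by (simp add: inj_eq)
  moreover have "(g ^^ k) y \<in> D" by (induction k) (use xy sub in auto)
  ultimately have "y \<in> g ` D" by blast
  then show ?thesis
    using halftree_eqI[OF halftree_image[OF g D] D xy(1)] xy sub by blast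
qed

lemma cut_edge_fixed:
  assumes g: "g \<in> carrier (aut_group adj lab)" and D: "halftree adj D" "g ` D = D"
    and xy: "adj x y" "x \<notin> D" "y \<in> D"
  shows "g x = x"
proof -
  have "inj g" using aut_groupD(1)[OF g] by (rule bij_is_inj)
  then have "g x \<notin> D" "g y \<in> D" using D(2) xy inj_image_mem_iff by (metis, blast)
  then show ?thesis
    using cut_edge_unique[OF D(1) adj_sym[OF xy(1)] xy(3,2), of "g y" "g x"]
      aut_groupD(2)[OF g] xy(1) adj_sym by blast
qed

text \<open>
  If \<open>u\<close> and \<open>v\<close> are fixed by \<open>g\<close>, then the half-trees beyond the first step \<open>w\<close> and beyond \<open>g w\<close>
  on the way from \<open>u\<close> to \<open>v\<close> are nested and hence have the same bounding edge.
\<close>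

lemma subtree_fixed_points:
  assumes S: "S \<subseteq> carrier (aut_group adj lab)"
  shows "is_subtree adj {v. \<forall>g\<in>S. g v = v}"
proof (rule subtreeI, clarify)
  fix u v w E g
  assume fixed: "\<forall>g\<in>S. g u = u" "\<forall>g\<in>S. g v = v" and uw: "adj u w"
    and E: "halftree adj E" "w \<in> E" "v \<in> E" "u \<notin> E" and g: "g \<in> S"
  have gA: "g \<in> carrier (aut_group adj lab)" using g S by blast
  have gE: "halftree adj (g ` E)" using halftree_image[OF gA E(1)] .
  have "inj g" using aut_groupD(1)[OF gA] by (rule bij_is_inj)
  then have u: "u \<notin> g ` E" using fixed(1) g E(4) by (metis inj_image_mem_iff)
  have v: "v \<in> g ` E" using fixed(2) g E(3) by (metis imageI)
  have ugw: "adj u (g w)" using aut_groupD(2)[OF gA, of u w] bspec[OF fixed(1) g] uw by simp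
  have "E \<subseteq> g ` E \<or> g ` E \<subseteq> E"
    using halftrees_nested[OF E(1) gE] v u E by blast
  then show "g w = w"
  proof
    assume "E \<subseteq> g ` E"
    then show ?thesis
      using cut_edge_unique[OF gE adj_sym[OF uw] _ u adj_sym[OF ugw]] u E(2) by blast
  next
    assume "g ` E \<subseteq> E"
    then show ?thesis
      using cut_edge_unique[OF E(1) adj_sym[OF uw] E(2,4) adj_sym[OF ugw]] E by blast
  qed
qed

end

lemma aut_invariantI:
  assumes "\<And>h. h \<in> carrier (aut_group adj lab) \<Longrightarrow> h ` Z \<subseteq> Z"
    and g: "g \<in> carrier (aut_group adj lab)"
  shows "g ` Z = Z"
proof (intro equalityI subsetI)
  fix x assume "x \<in> Z"
  then have "(inv\<^bsub>aut_group adj lab\<^esub> g) x \<in> Z"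
    using assms(1)[OF aut_group_inv(1)[OF g]] by blast
  then show "x \<in> g ` Z" using aut_group_inv(3)[OF g, of x] by (metis imageI)
qed (use assms in blast)

text \<open>
  The set \<open>S\<close> stands for the automorphisms that fix an edge.  It is closed under conjugation by the
  whole automorphism group, whereas \<open>\<D>\<close> is only required to be invariant under \<open>S\<close>; thus,
  if the members of \<open>\<D>\<close> pairwise meet, then so do any translate \<open>a D\<close> with \<open>D \<in> \<D>\<close> and its image
  under an element of \<open>S\<close>, although translates by different elements may be disjoint.
\<close>

lemma (in infinite_tree) disjoint_halftrees_in_invariant_family:
  fixes lab :: "'v \<Rightarrow> 'c"
  assumes no_invariant_subtree:
      "\<not> (\<exists>A. is_subtree adj A \<and> A \<noteq> {} \<and> A \<noteq> UNIV \<and>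
             (\<forall>g \<in> carrier (aut_group adj lab). g ` A = A))"
    and no_invariant_end:
      "\<not> (\<exists>e \<in> tree_ends adj. \<forall>g \<in> carrier (aut_group adj lab). (\<lambda>r. g \<circ> r) ` e = e)"
    and S: "S \<subseteq> carrier (aut_group adj lab)"
    and elliptic: "\<And>g. g \<in> S \<Longrightarrow> \<exists>v. g v = v"
    and conj: "\<And>a g. a \<in> carrier (aut_group adj lab) \<Longrightarrow> g \<in> S \<Longrightarrow>
                 inv\<^bsub>aut_group adj lab\<^esub> a \<circ> g \<circ> a \<in> S"
    and nontrivial: "g0 \<in> S" "g0 \<noteq> id"
    and half: "\<And>D. D \<in> \<D> \<Longrightarrow> halftree adj D" and nonempty: "\<D> \<noteq> {}"
    and up: "\<And>D E. D \<in> \<D> \<Longrightarrow> halftree adj E \<Longrightarrow> D \<subseteq> E \<Longrightarrow> E \<in> \<D>"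
    and inv\<D>: "\<And>g D. g \<in> S \<Longrightarrow> D \<in> \<D> \<Longrightarrow> g ` D \<in> \<D>"
  shows "\<exists>D\<in>\<D>. \<exists>E\<in>\<D>. D \<inter> E = {}"
proof (rule ccontr)
  assume no_disjoint: "\<not> ?thesis"
  let ?A = "carrier (aut_group adj lab)"
  let ?i = "\<lambda>a. inv\<^bsub>aut_group adj lab\<^esub> a"
  interpret A: group "aut_group adj lab" by (rule group_aut_group)
  define \<A> where "\<A> = {a ` D | a D. a \<in> ?A \<and> D \<in> \<D>}"
  have half\<A>: "halftree adj D" if "D \<in> \<A>" for D
    using that half halftree_image unfolding \<A>_def by blast
  have image_inv: "a ` (?i a ` E) = E" "?i a ` (a ` E) = E" if "a \<in> ?A" for a E
    using aut_group_inv(2,3)[OF that] by (simp_all add: image_image)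
  have up\<A>: "E \<in> \<A>" if D: "D \<in> \<A>" and E: "halftree adj E" "D \<subseteq> E" for D E
  proof -
    obtain a D' where a: "a \<in> ?A" "D' \<in> \<D>" "D = a ` D'" using D unfolding \<A>_def by blast
    have "D' \<subseteq> ?i a ` E" using image_inv(2)[OF a(1), of D'] a(3) E(2) by blast
    then have "?i a ` E \<in> \<D>"
      using up[OF a(2) halftree_image[OF aut_group_inv(1)[OF a(1)] E(1)]] by blast
    then show ?thesis using image_inv(1)[OF a(1), of E] a(1) unfolding \<A>_def by blast
  qed
  have inv\<A>: "g ` D \<in> \<A>" if g: "g \<in> ?A" and "D \<in> \<A>" for g D
  proof -
    obtain a D' where a: "a \<in> ?A" "D' \<in> \<D>" "D = a ` D'"
      using \<open>D \<in> \<A>\<close> unfolding \<A>_def by blast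
    have "g \<circ> a \<in> ?A" using A.m_closed[OF g a(1)] by simp
    moreover have "g ` D = (g \<circ> a) ` D'" using a(3) by (simp add: image_comp)
    ultimately show ?thesis using a(2) unfolding \<A>_def by blast
  qed
  have \<A>_nonempty: "\<A> \<noteq> {}" using nonempty A.one_closed unfolding \<A>_def by blast
  show False
  proof (cases "\<forall>D\<in>\<A>. \<forall>E\<in>\<A>. D \<inter> E \<noteq> {}")
    case meet: True
    show False
    proof (cases "\<Inter>\<A> = {}")
      case True
      interpret meeting_halftrees adj \<A>
        using half\<A> meet up\<A> True by unfold_locales blast+
      show False
        using no_invariant_end limit_end_in_tree_ends limit_end_invariant[of _ lab] inv\<A> by blast
    next
      case False
      have "h ` \<Inter>\<A> \<subseteq> \<Inter>\<A>" if h: "h \<in> ?A" for h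
      proof (rule image_subsetI, rule InterI)
        fix x D assume "x \<in> \<Inter>\<A>" and D: "D \<in> \<A>"
        then have "x \<in> ?i h ` D" using inv\<A>[OF aut_group_inv(1)[OF h] D] by blast
        then show "h x \<in> D" using aut_group_inv(3)[OF h] by auto
      qed
      then have "\<forall>g\<in>?A. g ` \<Inter>\<A> = \<Inter>\<A>" using aut_invariantI[of adj lab "\<Inter>\<A>"] by blast
      moreover have "\<Inter>\<A> \<noteq> UNIV" using \<A>_nonempty half\<A> unfolding halftree_def by blast
      ultimately show False
        using no_invariant_subtree False subtree_Inter_halftrees[OF half\<A>, of \<A>] by blast
    qed
  next
    case False
    \<comment> \<open>As \<open>\<A>\<close> is closed under enlarging, it contains both sides of an edge.\<close>
    then obtain D E where DE: "D \<in> \<A>" "E \<in> \<A>" "D \<inter> E = {}" by blast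
    have D: "halftree adj D" using half\<A>[OF DE(1)] .
    have D': "- D \<in> \<A>" using up\<A>[OF DE(2), of "- D"] D DE(3) by auto
    have self_meet: "F \<inter> g ` F \<noteq> {}" if F: "F \<in> \<A>" and g: "g \<in> S" for F g
    proof -
      obtain a F' where a: "a \<in> ?A" "F' \<in> \<D>" "F = a ` F'" using F unfolding \<A>_def by blast
      have "(?i a \<circ> g \<circ> a) ` F' \<in> \<D>" using inv\<D>[OF conj[OF a(1) g] a(2)] .
      then obtain p q where "p \<in> F'" "q \<in> F'" "p = ?i a (g (a q))"
        using no_disjoint a(2) by fastforce
      then show ?thesis using aut_group_inv(3)[OF a(1)] a(3) by auto
    qed
    obtain x y where xy: "adj x y" "x \<notin> D" "y \<in> D" using D by (rule cut_edge_exists)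
    have x_fixed: "g x = x" if g: "g \<in> S" for g
    proof -
      have gA: "g \<in> ?A" using g S by blast
      obtain v where v: "g v = v" using elliptic[OF g] by blast
      have "g ` (- D) = - g ` D" using aut_groupD(1)[OF gA] by (rule bij_image_Compl_eq)
      then have "D \<subseteq> g ` D \<or> g ` D \<subseteq> D"
        using halftrees_nested[OF D halftree_image[OF gA D]] self_meet[OF DE(1) g]
          self_meet[OF D' g] by simp
      then have "g ` D = D"
      proof
        assume "D \<subseteq> g ` D"
        then have "?i g ` D \<subseteq> D" using image_inv(2)[OF gA, of D] by blast
        moreover have "?i g v = v" using aut_group_inv(2)[OF gA, of v] v by simp
        ultimately have "?i g ` D = D"
          using elliptic_halftree_image_eq[OF aut_group_inv(1)[OF gA] _ D] by blast
        then show ?thesis using image_inv(1)[OF gA, of D] by simp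
      qed (rule elliptic_halftree_image_eq[OF gA v D])
      then show ?thesis using cut_edge_fixed[OF gA D _ xy] by blast
    qed
    let ?F = "{v. \<forall>g\<in>S. g v = v}"
    have "h ` ?F \<subseteq> ?F" if h: "h \<in> ?A" for h
    proof clarify
      fix v g assume v: "\<forall>g\<in>S. g v = v" and g: "g \<in> S"
      have "?i h (g (h v)) = v" using v conj[OF h g] by (metis comp_apply)
      then show "g (h v) = h v" using aut_group_inv(3)[OF h, of "g (h v)"] by simp
    qed
    then have "\<forall>g\<in>?A. g ` ?F = ?F" using aut_invariantI[of adj lab ?F] by blast
    moreover have "?F \<noteq> {}" using x_fixed by blast
    moreover have "?F \<noteq> UNIV"
    proof
      assume "?F = UNIV"
      then have "g0 v = v" for v using nontrivial(1) by blast
      with nontrivial(2) show False by (auto simp: fun_eq_iff)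
    qed
    ultimately show False using no_invariant_subtree subtree_fixed_points[OF S] by blast
  qed
qed

section \<open>The permutation topology\<close>

abbreviation eval_topology :: "('v \<Rightarrow> 'v) topology" where
  "eval_topology \<equiv> product_topology (\<lambda>_. discrete_topology UNIV) UNIV"

lemma openin_eval: "openin eval_topology {g. g v = w}"
  using openin_continuous_map_preimage[OF continuous_map_product_projection[of v UNIV
        "\<lambda>_. discrete_topology UNIV"], of "{w}"] by simp

lemma openin_eval2: "openin eval_topology {g. P (g u) (g v)}"
proof -
  have "{g. P (g u) (g v)} = (\<Union>(a, b) \<in> {(a, b). P a b}. {g. g u = a} \<inter> {g. g v = b})"
    by auto
  also have "openin eval_topology \<dots>" by (intro openin_Union) (auto intro: openin_Int openin_eval)
  finally show ?thesis .
qed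

lemma closedin_eval2: "closedin eval_topology {g. P (g u) (g v)}"
proof -
  have "topspace eval_topology - {g. P (g u) (g v)} = {g. \<not> P (g u) (g v)}" by auto
  then show ?thesis using openin_eval2[of "\<lambda>a b. \<not> P a b" u v] by (simp add: closedin_def)
qed

context label_regular_tree
begin

text \<open>
  Surjectivity comes for free: vertices with the same label have the same degree, so the injective
  map \<open>g\<close> is onto from the neighbours of \<open>v\<close> to those of \<open>g v\<close>, and the range of \<open>g\<close>
  is closed under adjacency.  The remaining conditions involve two values of \<open>g\<close> at a time,
  which is why the automorphism group is closed in the space of all maps.
\<close>

lemma local_isomorphism_in_aut_group:
  assumes loc: "\<And>u v. (g u = g v \<longrightarrow> u = v) \<and> (adj (g u) (g v) \<longleftrightarrow> adj u v) \<and> lab (g u) = lab u"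
  shows "g \<in> carrier (aut_group adj lab)"
proof -
  have inj: "inj g" using loc by (auto intro: injI)
  have nbrs_g: "g ` nbrs adj v = nbrs adj (g v)" for v
  proof (rule card_subset_eq[OF locally_finite])
    show "g ` nbrs adj v \<subseteq> nbrs adj (g v)" using loc by (auto simp: nbrs_def)
    have "size (image_mset lab (mset_set (nbrs adj (g v)))) = size (image_mset lab (mset_set (nbrs adj v)))"
      using label_regular[of "g v" v] loc by simp
    then show "card (g ` nbrs adj v) = card (nbrs adj (g v))"
      using inj by (simp add: card_image inj_on_subset)
  qed
  have "w \<in> range g" for w
    using tree_connected[of "g undefined" w]
  proof (induction rule: rtranclp_induct)
    case (step y z)
    then obtain x where "y = g x" by blast
    with step.hyps(2) have "z \<in> g ` nbrs adj x" using nbrs_g by (simp add: nbrs_def)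
    then show ?case by blast
  qed simp
  then have "surj g" by blast
  with inj loc show ?thesis by (simp add: aut_group_def bij_def)
qed

lemma closedin_aut_group: "closedin eval_topology (carrier (aut_group adj lab))"
proof -
  let ?P = "\<lambda>u v a b. (a = b \<longrightarrow> u = v) \<and> (adj a b \<longleftrightarrow> adj u v) \<and> lab a = lab u"
  have "carrier (aut_group adj lab) = \<Inter>{{g. ?P u v (g u) (g v)} | u v. True}"
  proof (intro equalityI subsetI)
    fix g assume g: "g \<in> carrier (aut_group adj lab)"
    then have "inj g" using aut_groupD(1) bij_is_inj by blast
    then show "g \<in> \<Inter>{{g. ?P u v (g u) (g v)} | u v. True}"
      using aut_groupD(2,3)[OF g] by (auto dest: injD)
  next
    fix g assume "g \<in> \<Inter>{{g. ?P u v (g u) (g v)} | u v. True}"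
    then have "?P u v (g u) (g v)" for u v by blast
    then show "g \<in> carrier (aut_group adj lab)" by (rule local_isomorphism_in_aut_group)
  qed
  also have "closedin eval_topology \<dots>"
  proof (rule closedin_Inter)
    fix Z assume "Z \<in> {{g. ?P u v (g u) (g v)} | u v. True}"
    then obtain u v where "Z = {g. ?P u v (g u) (g v)}" by blast
    then show "closedin eval_topology Z" using closedin_eval2[of "?P u v" u v] by simp
  qed blast
  finally show ?thesis .
qed

lemma closedin_aut_plus: "closedin eval_topology (aut_plus adj lab)"
  using closedin_trans_full[OF _ closedin_aut_group] aut_plus_closed_subgroup
  unfolding aut_topology_def by blast

lemma aut_plus_topology_eq:
  "aut_plus_topology adj lab = subtopology eval_topology (aut_plus adj lab)"
proof -
  have "aut_plus adj lab \<subseteq> carrier (aut_group adj lab)"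
    using aut_plus_closed_subgroup subgroup.subset by blast
  then show ?thesis
    by (simp add: aut_plus_topology_def aut_topology_def subtopology_subtopology inf.absorb2)
qed

text \<open>
  By local finiteness the value at one vertex leaves finitely many choices at every other vertex, so
  the set is closed in a product of finite sets.
\<close>

lemma compactin_bounded_displacement:
  assumes B: "finite B"
  shows "compactin (aut_plus_topology adj lab) {h \<in> aut_plus adj lab. h x \<in> B}"
proof -
  let ?C = "{h \<in> aut_plus adj lab. h x \<in> B}"
  let ?K = "PiE UNIV (\<lambda>v. (\<lambda>h. h v) ` ?C)"
  have "finite ((\<lambda>h. h x) ` ?C)" using B by (rule finite_subset[rotated]) blast
  moreover have "?C \<subseteq> carrier (aut_group adj lab)"
    using aut_plus_closed_subgroup subgroup.subset by blast
  ultimately have "finite ((\<lambda>h. h v) ` ?C)" for v by (metis (no_types, lifting) finite_orbit)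
  then have "compactin eval_topology ?K"
    by (simp add: compactin_PiE compactin_discrete_topology)
  moreover have "?C \<subseteq> ?K" by auto
  moreover have "?C = aut_plus adj lab \<inter> {h. h x \<in> B}" by blast
  then have "closedin eval_topology ?C"
    using closedin_aut_plus closedin_eval2[of "\<lambda>a b. a \<in> B" x x] by (simp add: closedin_Int)
  ultimately have "compactin eval_topology ?C" by (rule closed_compactin)
  then show ?thesis by (simp add: aut_plus_topology_eq compactin_subtopology)
qed

lemma identity_neighbourhood:
  assumes "openin (aut_plus_topology adj lab) U" "id \<in> U"
  obtains B where "finite B" "\<And>h. h \<in> aut_plus adj lab \<Longrightarrow> (\<And>b. b \<in> B \<Longrightarrow> h b = b) \<Longrightarrow> h \<in> U"
proof -
  obtain T where T: "openin eval_topology T" "U = T \<inter> aut_plus adj lab"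
    using assms(1) by (auto simp: aut_plus_topology_eq openin_subtopology)
  then obtain V where V: "finite {i. V i \<noteq> UNIV}" "id \<in> PiE UNIV V" "PiE UNIV V \<subseteq> T"
    using assms(2) unfolding openin_product_topology_alt by fastforce
  show ?thesis
  proof (rule that[OF V(1)])
    fix h assume h: "h \<in> aut_plus adj lab" and fixes_V: "\<And>b. b \<in> {i. V i \<noteq> UNIV} \<Longrightarrow> h b = b"
    have "h b \<in> V b" for b
    proof (cases "V b = UNIV")
      case False
      then have "h b = id b" using fixes_V by simp
      then show ?thesis using V(2) by (metis PiE_mem UNIV_I)
    qed simp
    then show "h \<in> U" using T(2) V(3) h by auto
  qed
qed

end

section \<open>The range of a continuous homomorphism\<close>

definition edge_fixers :: "('v \<Rightarrow> 'v \<Rightarrow> bool) \<Rightarrow> ('v \<Rightarrow> 'c) \<Rightarrow> ('v \<Rightarrow> 'v) set" where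
  "edge_fixers adj lab = \<Union>{edge_fix adj lab u v | u v. adj u v}"

lemma edge_fixers_iff:
  "g \<in> edge_fixers adj lab \<longleftrightarrow>
     g \<in> carrier (aut_group adj lab) \<and> (\<exists>u v. adj u v \<and> g u = u \<and> g v = v)"
  by (auto simp: edge_fixers_def edge_fix_def)

lemma edge_fixers_subset: "edge_fixers adj lab \<subseteq> aut_plus adj lab"
  unfolding edge_fixers_def aut_plus_def by (rule hull_subset)

lemma edge_fixers_conj:
  assumes a: "a \<in> carrier (aut_group adj lab)" and g: "g \<in> edge_fixers adj lab"
  shows "inv\<^bsub>aut_group adj lab\<^esub> a \<circ> g \<circ> a \<in> edge_fixers adj lab"
proof -
  interpret A: group "aut_group adj lab" by (rule group_aut_group)
  let ?i = "inv\<^bsub>aut_group adj lab\<^esub> a"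
  obtain u v where gA: "g \<in> carrier (aut_group adj lab)" and uv: "adj u v" "g u = u" "g v = v"
    using g by (auto simp: edge_fixers_iff)
  have "?i \<otimes>\<^bsub>aut_group adj lab\<^esub> g \<otimes>\<^bsub>aut_group adj lab\<^esub> a \<in> carrier (aut_group adj lab)"
    using a gA A.inv_closed A.m_closed by blast
  moreover have "adj (?i u) (?i v)" using aut_groupD(2)[OF aut_group_inv(1)[OF a]] uv(1) by simp
  ultimately show ?thesis
    using uv(2,3) aut_group_inv(3)[OF a] unfolding edge_fixers_iff
    by (intro conjI exI[of _ "?i u"] exI[of _ "?i v"]) simp_all
qed

lemma aut_plus_subgroup: "subgroup (aut_plus adj lab) (aut_group adj lab)"
  using aut_plus_closed_subgroup by blast

text \<open>
  The independence property: the only edge between \<open>D\<close> and its complement is fixed by \<open>g\<close>, so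
  the action of \<open>g\<close> on \<open>D\<close> can be combined with the identity outside \<open>D\<close>.
\<close>

lemma (in infinite_tree) aut_restrict_halftree:
  assumes g: "g \<in> carrier (aut_group adj lab)" and uv: "adj u v" "g u = u" "g v = v"
    and D: "halftree adj D" "v \<in> D" "u \<notin> D"
  shows "g ` D = D" and "(\<lambda>w. if w \<in> D then g w else w) \<in> carrier (aut_group adj lab)"
proof -
  let ?h = "\<lambda>w. if w \<in> D then g w else w"
  have inj: "inj g" using aut_groupD(1)[OF g] by (rule bij_is_inj)
  have gu: "u \<notin> g ` D" using inj D(3) uv(2) by (metis inj_image_mem_iff)
  have gv: "v \<in> g ` D" using D(2) uv(3) by (metis imageI)
  show gD: "g ` D = D"
    using halftree_eqI[OF halftree_image[OF g D(1)] D(1) uv(1) gv gu D(2,3)] .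
  then have mem: "g w \<in> D \<longleftrightarrow> w \<in> D" for w using inj inj_image_mem_iff by metis
  have "inj ?h"
  proof (rule injI)
    fix a b assume "?h a = ?h b"
    then show "a = b"
      using mem[of a] mem[of b] injD[OF inj, of a b] by (cases "a \<in> D"; cases "b \<in> D") auto
  qed
  moreover have "surj ?h"
  proof -
    have "y \<in> range ?h" for y
    proof (cases "y \<in> D")
      case True
      then obtain w where "w \<in> D" "y = g w" using gD by blast
      then show ?thesis by (intro image_eqI[of _ _ w]) simp_all
    next
      case False
      then show ?thesis by (intro image_eqI[of _ _ y]) simp_all
    qed
    then show ?thesis by blast
  qed
  moreover have "adj (?h a) (?h b) \<longleftrightarrow> adj a b" for a b
  proof -
    have cut: "adj a b \<longleftrightarrow> a = v \<and> b = u" if "a \<in> D" "b \<notin> D" for a b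
      using cut_edge_unique[OF D(1) adj_sym[OF uv(1)] D(2,3) _ that] adj_sym[OF uv(1)] by blast
    have gv_iff: "g a = v \<longleftrightarrow> a = v" for a using inj uv(3) by (metis injD)
    have cut': "adj (g a) b \<longleftrightarrow> adj a b" if "a \<in> D" "b \<notin> D" for a b
      using cut[of a b] cut[of "g a" b] that mem gv_iff by simp
    show ?thesis
      using aut_groupD(2)[OF g] cut' adj_sym by (cases "a \<in> D"; cases "b \<in> D") (simp_all, blast+)
  qed
  moreover have "lab (?h w) = lab w" for w using aut_groupD(3)[OF g] by simp
  ultimately show "?h \<in> carrier (aut_group adj lab)" by (simp add: aut_group_def bij_def)
qed

lemma (in topological_group) continuous_map_m_mult:
  assumes "continuous_map Y X f" "continuous_map Y X g"
  shows "continuous_map Y X (\<lambda>y. f y \<otimes> g y)"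
  using continuous_map_compose[of Y "prod_topology X X" "\<lambda>y. (f y, g y)" X "\<lambda>(x, y). x \<otimes> y"]
    assms continuous_mult by (simp add: continuous_map_paired comp_def)

lemma (in topological_group) conj_neighbourhood:
  assumes p: "p \<in> carrier G" "p \<noteq> \<one>" and g: "g \<in> carrier G"
  obtains W N where "openin X W" "g \<in> W" "openin X N" "\<one> \<in> N"
    "\<And>w. w \<in> W \<Longrightarrow> w \<otimes> p \<otimes> inv w \<notin> N"
proof -
  let ?q = "g \<otimes> p \<otimes> inv g"
  have "?q \<noteq> \<one>"
  proof
    assume "?q = \<one>"
    then have "g \<otimes> p = g" using p g by (metis inv_equality inv_inv inv_closed m_closed)
    then show False using p g by (simp add: l_cancel_one')
  qed
  moreover have "?q \<in> topspace X" "\<one> \<in> topspace X" using p g by (simp_all add: topspace_eq)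
  ultimately obtain O1 N where O1: "openin X O1" "?q \<in> O1" and N: "openin X N" "\<one> \<in> N"
    and disj: "disjnt O1 N"
    using Hausdorff unfolding Hausdorff_space_def by blast
  have "continuous_map X X (\<lambda>w. w \<otimes> p \<otimes> inv w)"
    using p by (intro continuous_map_m_mult continuous_inv)
      (simp_all add: continuous_map_id[unfolded id_def] topspace_eq)
  then have "openin X {w \<in> topspace X. w \<otimes> p \<otimes> inv w \<in> O1}"
    using O1(1) by (rule openin_continuous_map_preimage)
  then show ?thesis
    using O1(2) N disj g that[of "{w \<in> topspace X. w \<otimes> p \<otimes> inv w \<in> O1}" N]
    by (auto simp: topspace_eq disjnt_iff)
qed

text \<open>
  The vertices of a path from \<open>a\<close> to \<open>b\<close> form such a set, which serves all sets \<open>D\<close> at once.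
\<close>

lemma (in infinite_tree) finite_crossing_set:
  "\<exists>P. finite P \<and> (\<forall>D. a \<in> D \<longrightarrow> b \<notin> D \<longrightarrow> (\<exists>x y. x \<in> P \<and> adj x y \<and> x \<in> D \<and> y \<notin> D))"
  using tree_connected[of a b]
proof (induction rule: rtranclp_induct)
  case base
  show ?case by blast
next
  case (step y z)
  then obtain P where P: "finite P"
    "\<forall>D. a \<in> D \<longrightarrow> y \<notin> D \<longrightarrow> (\<exists>x y. x \<in> P \<and> adj x y \<and> x \<in> D \<and> y \<notin> D)" by blast
  show ?case
    by (rule exI[of _ "insert y P"]) (use P step.hyps(2) in blast)
qed

locale aut_plus_hom = label_regular_tree adj lab + topological_group G X
  for adj :: "'v \<Rightarrow> 'v \<Rightarrow> bool" and lab :: "'v \<Rightarrow> 'c"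
    and G :: "('g, 'm) monoid_scheme" (structure) and X :: "'g topology" +
  fixes \<phi> :: "('v \<Rightarrow> 'v) \<Rightarrow> 'g"
  assumes hom: "\<phi> \<in> hom (aut_plus_group adj lab) G"
    and continuous: "continuous_map (aut_plus_topology adj lab) X \<phi>"
begin

abbreviation H :: "('v \<Rightarrow> 'v) set" where "H \<equiv> aut_plus adj lab"

abbreviation inverse_aut :: "('v \<Rightarrow> 'v) \<Rightarrow> 'v \<Rightarrow> 'v" where
  "inverse_aut h \<equiv> inv\<^bsub>aut_group adj lab\<^esub> h"

lemma H_aut: "h \<in> H \<Longrightarrow> h \<in> carrier (aut_group adj lab)"
  using subgroup.subset[OF aut_plus_subgroup] by blast

lemma H_closed: "id \<in> H" "h \<in> H \<Longrightarrow> k \<in> H \<Longrightarrow> h \<circ> k \<in> H" "h \<in> H \<Longrightarrow> inverse_aut h \<in> H"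
  using subgroup.one_closed[OF aut_plus_subgroup, of adj lab]
    subgroup.m_closed[OF aut_plus_subgroup, of h adj lab k]
    subgroup.m_inv_closed[OF aut_plus_subgroup, of h adj lab] by simp_all

lemma phi_closed: "h \<in> H \<Longrightarrow> \<phi> h \<in> carrier G"
  and phi_comp: "h \<in> H \<Longrightarrow> k \<in> H \<Longrightarrow> \<phi> (h \<circ> k) = \<phi> h \<otimes> \<phi> k"
  using hom by (auto simp: hom_def aut_plus_group_def)

lemma phi_id: "\<phi> id = \<one>"
  using phi_comp[OF H_closed(1,1)] phi_closed[OF H_closed(1)] by (simp add: l_cancel_one)

lemma phi_inverse:
  assumes "h \<in> H"
  shows "\<phi> (inverse_aut h) = inv (\<phi> h)"
proof -
  have "inverse_aut h \<circ> h = id" using aut_group_inv(2)[OF H_aut[OF assms]] by (simp add: fun_eq_iff)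
  then have "\<phi> (inverse_aut h) \<otimes> \<phi> h = \<one>"
    using phi_comp[OF H_closed(3)[OF assms] assms] phi_id by simp
  then show ?thesis using inv_equality phi_closed assms H_closed(3) by metis
qed

lemma phi_conj:
  assumes "h \<in> H" "u \<in> H"
  shows "h \<circ> u \<circ> inverse_aut h \<in> H" "\<phi> (h \<circ> u \<circ> inverse_aut h) = \<phi> h \<otimes> \<phi> u \<otimes> inv (\<phi> h)"
  using assms H_closed by (simp_all add: phi_comp phi_inverse)

text \<open>
  The kernel is a closed subgroup, and \<open>H\<close> is the smallest closed subgroup containing the
  automorphisms that fix an edge.
\<close>

lemma phi_trivial:
  assumes triv: "\<And>g. g \<in> edge_fixers adj lab \<Longrightarrow> \<phi> g = \<one>" and h: "h \<in> H"
  shows "\<phi> h = \<one>"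
proof -
  let ?K = "{h \<in> H. \<phi> h = \<one>}"
  have "subgroup ?K (aut_group adj lab)"
    using H_aut H_closed phi_comp phi_inverse phi_id by (intro subgroup.intro) auto
  moreover have "closedin (aut_topology adj lab) ?K"
  proof -
    have top: "topspace (aut_plus_topology adj lab) = H" by (simp add: aut_plus_topology_eq)
    have "closedin X {\<one>}" using Hausdorff by (simp add: closedin_Hausdorff_sing_eq topspace_eq)
    from closedin_continuous_map_preimage[OF continuous this]
    have "closedin (aut_plus_topology adj lab) ?K" by (simp add: top)
    then show ?thesis
      using closedin_trans_full aut_plus_closed_subgroup unfolding aut_plus_topology_def by blast
  qed
  moreover have "edge_fixers adj lab \<subseteq> ?K" using triv edge_fixers_subset by blast
  ultimately have "H \<subseteq> ?K"
    unfolding aut_plus_def edge_fixers_def by (intro hull_minimal) auto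
  then show ?thesis using h by blast
qed

definition essential_halftrees :: "'v set set" where
  "essential_halftrees =
     {D. halftree adj D \<and> (\<exists>u\<in>H. (\<forall>v. v \<notin> D \<longrightarrow> u v = v) \<and> \<phi> u \<noteq> \<one>)}"

lemma essential_halftrees_nonempty:
  assumes g: "g \<in> edge_fixers adj lab" and nontriv: "\<phi> g \<noteq> \<one>"
  shows "essential_halftrees \<noteq> {}"
proof -
  obtain u v where gA: "g \<in> carrier (aut_group adj lab)" and uv: "adj u v" "g u = u" "g v = v"
    using g by (auto simp: edge_fixers_iff)
  obtain D where D: "halftree adj D" "v \<in> D" "u \<notin> D" using halftree_of_edge[OF uv(1)] .
  let ?g1 = "\<lambda>w. if w \<in> D then g w else w" and ?g2 = "\<lambda>w. if w \<in> - D then g w else w"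
  have "?g1 \<in> carrier (aut_group adj lab)" using aut_restrict_halftree(2)[OF gA uv D] .
  then have "?g1 \<in> edge_fixers adj lab"
    unfolding edge_fixers_iff using uv D by (intro conjI exI[of _ u] exI[of _ v]) simp_all
  then have g1: "?g1 \<in> H" using edge_fixers_subset by blast
  have "?g2 \<in> carrier (aut_group adj lab)"
    using aut_restrict_halftree(2)[OF gA adj_sym[OF uv(1)] uv(3,2), of "- D"] D by simp
  then have "?g2 \<in> edge_fixers adj lab"
    unfolding edge_fixers_iff using uv D by (intro conjI exI[of _ u] exI[of _ v]) simp_all
  then have g2: "?g2 \<in> H" using edge_fixers_subset by blast
  have "g w \<notin> D" if "w \<notin> D" for w
    using aut_restrict_halftree(1)[OF gA uv D] aut_groupD(1)[OF gA] that
    by (metis bij_is_inj inj_image_mem_iff)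
  then have "?g1 \<circ> ?g2 = g" by (auto simp: fun_eq_iff)
  then have "\<phi> g = \<phi> ?g1 \<otimes> \<phi> ?g2" using phi_comp[OF g1 g2] by simp
  with nontriv have "\<phi> ?g1 \<noteq> \<one> \<or> \<phi> ?g2 \<noteq> \<one>" by auto
  then have "D \<in> essential_halftrees \<or> - D \<in> essential_halftrees"
  proof
    assume "\<phi> ?g1 \<noteq> \<one>"
    then have "D \<in> essential_halftrees"
      using D(1) g1 unfolding essential_halftrees_def by (intro CollectI conjI bexI[of _ ?g1]) auto
    then show ?thesis ..
  next
    assume "\<phi> ?g2 \<noteq> \<one>"
    then have "- D \<in> essential_halftrees"
      using D(1) g2 unfolding essential_halftrees_def by (intro CollectI conjI bexI[of _ ?g2]) auto
    then show ?thesis ..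
  qed
  then show ?thesis by blast
qed

lemma essential_halftrees_up:
  assumes "D \<in> essential_halftrees" "halftree adj E" "D \<subseteq> E"
  shows "E \<in> essential_halftrees"
  using assms unfolding essential_halftrees_def by blast

lemma essential_halftrees_image:
  assumes h: "h \<in> H" and D: "D \<in> essential_halftrees"
  shows "h ` D \<in> essential_halftrees"
proof -
  obtain u where u: "u \<in> H" "\<And>v. v \<notin> D \<Longrightarrow> u v = v" "\<phi> u \<noteq> \<one>" and half: "halftree adj D"
    using D unfolding essential_halftrees_def by blast
  let ?u = "h \<circ> u \<circ> inverse_aut h"
  have "?u v = v" if "v \<notin> h ` D" for v
  proof -
    have "inverse_aut h v \<notin> D" using that aut_group_inv(3)[OF H_aut[OF h], of v] by (metis imageI)
    then show ?thesis using u(2) aut_group_inv(3)[OF H_aut[OF h]] by simp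
  qed
  moreover have "\<phi> ?u \<noteq> \<one>"
  proof
    assume "\<phi> ?u = \<one>"
    then have "\<phi> h \<otimes> \<phi> u = \<phi> h"
      using phi_conj(2)[OF h u(1)] phi_closed[OF h] phi_closed[OF u(1)]
      by (metis inv_equality inv_inv inv_closed m_closed)
    then show False using u(3) phi_closed[OF h] phi_closed[OF u(1)] by (simp add: l_cancel_one')
  qed
  ultimately show ?thesis
    using halftree_image[OF H_aut[OF h] half] phi_conj(1)[OF h u(1)]
    unfolding essential_halftrees_def by blast
qed

text \<open>
  With \<open>u\<close> supported in \<open>D\<close>, the conjugate of \<open>u\<close> by \<open>h\<close> is supported in \<open>h D\<close>.  If \<open>\<phi> h\<close> is close
  to \<open>g\<close>, then the image of this conjugate stays away from \<open>\<one>\<close>, so the conjugate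
  cannot fix a large finite set \<open>B\<close> pointwise.
\<close>

lemma essential_halftree_recurrence:
  assumes D: "D \<in> essential_halftrees" and g: "g \<in> carrier G"
  obtains W B where "openin X W" "g \<in> W" "finite B"
    "\<And>h. h \<in> H \<Longrightarrow> \<phi> h \<in> W \<Longrightarrow> h ` D \<inter> B \<noteq> {}"
proof -
  obtain u where u: "u \<in> H" "\<And>v. v \<notin> D \<Longrightarrow> u v = v" "\<phi> u \<noteq> \<one>"
    using D unfolding essential_halftrees_def by blast
  obtain W N where W: "openin X W" "g \<in> W" and N: "openin X N" "\<one> \<in> N"
    and WN: "\<And>w. w \<in> W \<Longrightarrow> w \<otimes> \<phi> u \<otimes> inv w \<notin> N"
    using conj_neighbourhood[OF phi_closed[OF u(1)] u(3) g] by blast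
  have top: "topspace (aut_plus_topology adj lab) = H" by (simp add: aut_plus_topology_eq)
  have "openin (aut_plus_topology adj lab) {h \<in> H. \<phi> h \<in> N}"
    using openin_continuous_map_preimage[OF continuous N(1)] by (simp add: top)
  then obtain B where B: "finite B"
    "\<And>h. h \<in> H \<Longrightarrow> (\<And>b. b \<in> B \<Longrightarrow> h b = b) \<Longrightarrow> h \<in> {h \<in> H. \<phi> h \<in> N}"
    using identity_neighbourhood[of "{h \<in> H. \<phi> h \<in> N}"] N(2) phi_id H_closed(1) by auto
  show ?thesis
  proof (rule that[OF W B(1)])
    fix h assume h: "h \<in> H" "\<phi> h \<in> W"
    let ?u = "h \<circ> u \<circ> inverse_aut h"
    have "\<phi> ?u \<notin> N" using WN[OF h(2)] phi_conj(2)[OF h(1) u(1)] by simp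
    then obtain b where b: "b \<in> B" "?u b \<noteq> b" using B(2)[OF phi_conj(1)[OF h(1) u(1)]] by blast
    have "inverse_aut h b \<in> D"
    proof (rule ccontr)
      assume "inverse_aut h b \<notin> D"
      then have "?u b = b" using u(2) aut_group_inv(3)[OF H_aut[OF h(1)], of b] by simp
      with b(2) show False by blast
    qed
    then show "h ` D \<inter> B \<noteq> {}"
      using b(1) aut_group_inv(3)[OF H_aut[OF h(1)], of b] by (metis disjoint_iff imageI)
  qed
qed

text \<open>
  The disjoint half-trees \<open>h D\<close> and \<open>h E\<close> each meet a finite set that does not depend on \<open>h\<close>, so
  the endpoint \<open>h y\<close> of the edge bounding \<open>h D\<close> lies on one of finitely many paths.
\<close>

lemma locally_bounded_preimage:
  assumes DE: "D \<in> essential_halftrees" "E \<in> essential_halftrees" "D \<inter> E = {}"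
    and g: "g \<in> carrier G" and y: "adj x y" "y \<in> D" "x \<notin> D"
  obtains W B where "openin X W" "g \<in> W" "finite B" "\<And>h. h \<in> H \<Longrightarrow> \<phi> h \<in> W \<Longrightarrow> h y \<in> B"
proof -
  obtain W1 B1 where 1: "openin X W1" "g \<in> W1" "finite B1"
    "\<And>h. h \<in> H \<Longrightarrow> \<phi> h \<in> W1 \<Longrightarrow> h ` D \<inter> B1 \<noteq> {}"
    using essential_halftree_recurrence[OF DE(1) g] by metis
  obtain W2 B2 where 2: "openin X W2" "g \<in> W2" "finite B2"
    "\<And>h. h \<in> H \<Longrightarrow> \<phi> h \<in> W2 \<Longrightarrow> h ` E \<inter> B2 \<noteq> {}"
    using essential_halftree_recurrence[OF DE(2) g] by metis
  obtain P where P: "\<And>a b. finite (P a b)"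
    "\<And>a b D. a \<in> D \<Longrightarrow> b \<notin> D \<Longrightarrow> \<exists>x y. x \<in> P a b \<and> adj x y \<and> x \<in> D \<and> y \<notin> D"
    using finite_crossing_set by metis
  show ?thesis
  proof (rule that)
    show "openin X (W1 \<inter> W2)" "g \<in> W1 \<inter> W2" using 1 2 by blast+
    show "finite (\<Union>a\<in>B1. \<Union>b\<in>B2. P a b)" using 1(3) 2(3) P(1) by blast
    fix h assume h: "h \<in> H" "\<phi> h \<in> W1 \<inter> W2"
    have inj: "inj h" using aut_groupD(1)[OF H_aut[OF h(1)]] by (rule bij_is_inj)
    obtain a b where ab: "a \<in> B1" "b \<in> B2" "a \<in> h ` D" "b \<in> h ` E"
      using 1(4)[OF h(1)] 2(4)[OF h(1)] h(2) by blast
    have "b \<notin> h ` D" using ab(4) DE(3) image_Int[OF inj, of D E] by auto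
    then obtain p q where pq: "p \<in> P a b" "adj p q" "p \<in> h ` D" "q \<notin> h ` D"
      using P(2)[OF ab(3)] by blast
    have half: "halftree adj (h ` D)"
      using DE(1) halftree_image[OF H_aut[OF h(1)]] unfolding essential_halftrees_def by blast
    have "adj (h y) (h x)" using aut_groupD(2)[OF H_aut[OF h(1)]] adj_sym[OF y(1)] by blast
    then have "p = h y"
      using cut_edge_unique[OF half _ _ _ pq(2-4)] y inj by (metis imageI inj_image_mem_iff)
    then show "h y \<in> (\<Union>a\<in>B1. \<Union>b\<in>B2. P a b)" using pq(1) ab by blast
  qed
qed

lemma closed_range_of_disjoint_pair:
  assumes DE: "D \<in> essential_halftrees" "E \<in> essential_halftrees" "D \<inter> E = {}"
  shows "closedin X (\<phi> ` H)"
proof -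
  have "halftree adj D" using DE(1) unfolding essential_halftrees_def by blast
  then obtain x y where xy: "adj x y" "x \<notin> D" "y \<in> D" by (rule cut_edge_exists)
  have "g \<in> \<phi> ` H" if cl: "g \<in> X closure_of (\<phi> ` H)" for g
  proof (rule ccontr)
    assume g: "g \<notin> \<phi> ` H"
    have "g \<in> carrier G" using cl by (simp add: in_closure_of topspace_eq)
    then obtain W B where W: "openin X W" "g \<in> W" "finite B" "\<And>h. h \<in> H \<Longrightarrow> \<phi> h \<in> W \<Longrightarrow> h y \<in> B"
      using locally_bounded_preimage[OF DE _ xy(1,3,2)] by metis
    let ?C = "{h \<in> H. h y \<in> B}"
    have "closedin X (\<phi> ` ?C)"
      using compactin_imp_closedin[OF Hausdorff]
        image_compactin[OF compactin_bounded_displacement[OF W(3)] continuous] by blast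
    then have "openin X (W - \<phi> ` ?C)" using W(1) by blast
    moreover have "g \<in> W - \<phi> ` ?C" using W(2) g by blast
    ultimately obtain h where "h \<in> H" "\<phi> h \<in> W - \<phi> ` ?C"
      using cl by (auto simp: in_closure_of)
    then show False using W(4) by blast
  qed
  moreover have "\<phi> ` H \<subseteq> topspace X" using phi_closed by (auto simp: topspace_eq)
  ultimately show ?thesis using closure_of_subset_eq by blast
qed

end

theorem theorem4p2:
  fixes adj :: "'v \<Rightarrow> 'v \<Rightarrow> bool" and lab :: "'v \<Rightarrow> 'c"
    and G :: "('g, 'm) monoid_scheme" and X :: "'g topology"
    and \<phi> :: "('v \<Rightarrow> 'v) \<Rightarrow> 'g"
  assumes tree: "label_regular_tree adj lab"
    and no_invariant_subtree:
      "\<not> (\<exists>A. is_subtree adj A \<and> A \<noteq> {} \<and> A \<noteq> UNIV \<and>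
             (\<forall>g \<in> carrier (aut_group adj lab). g ` A = A))"
    and no_invariant_end:
      "\<not> (\<exists>e \<in> tree_ends adj. \<forall>g \<in> carrier (aut_group adj lab). (\<lambda>r. g \<circ> r) ` e = e)"
    and topological_group: "topological_group G X"
    and hom: "\<phi> \<in> hom (aut_plus_group adj lab) G"
    and continuous: "continuous_map (aut_plus_topology adj lab) X \<phi>"
  shows "closedin X (\<phi> ` carrier (aut_plus_group adj lab))"
proof -
  interpret aut_plus_hom adj lab G X \<phi>
    using tree topological_group hom continuous
    by (simp add: aut_plus_hom_def aut_plus_hom_axioms_def)
  have "closedin X (\<phi> ` H)"
  proof (cases "\<forall>g \<in> edge_fixers adj lab. \<phi> g = \<one>\<^bsub>G\<^esub>")
    case True
    then have "\<phi> ` H = {\<one>\<^bsub>G\<^esub>}" using phi_trivial H_closed(1) phi_id by fastforce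
    then show ?thesis using Hausdorff by (simp add: closedin_Hausdorff_sing_eq topspace_eq)
  next
    case False
    then obtain g0 where g0: "g0 \<in> edge_fixers adj lab" "\<phi> g0 \<noteq> \<one>\<^bsub>G\<^esub>" by blast
    have "\<exists>D\<in>essential_halftrees. \<exists>E\<in>essential_halftrees. D \<inter> E = {}"
    proof (rule disjoint_halftrees_in_invariant_family[OF no_invariant_subtree no_invariant_end,
          of "edge_fixers adj lab" g0])
      show "g0 \<noteq> id" using g0(2) phi_id by blast
      show "essential_halftrees \<noteq> {}" using essential_halftrees_nonempty[OF g0] .
      show "halftree adj D" if "D \<in> essential_halftrees" for D
        using that unfolding essential_halftrees_def by blast
      show "\<exists>v. g v = v" if "g \<in> edge_fixers adj lab" for g
        using that unfolding edge_fixers_iff by blast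
      show "edge_fixers adj lab \<subseteq> carrier (aut_group adj lab)"
        using edge_fixers_subset H_aut by blast
      show "g ` D \<in> essential_halftrees"
        if "g \<in> edge_fixers adj lab" "D \<in> essential_halftrees" for g D
        using essential_halftrees_image that edge_fixers_subset by blast
    qed (rule g0(1) edge_fixers_conj essential_halftrees_up; assumption?)+
    then show ?thesis using closed_range_of_disjoint_pair by blast
  qed
  then show ?thesis by (simp add: aut_plus_group_def)
qed

end
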